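(* Let $A$ be a totally unimodular $r\times m$ matrix of rank $r$, let $M$ be the regular matroid represented by $A$, let $Z_A$ be the associated zonotope, and let $q$ be a positive integer. The number of interior lattice points in $qZ_A$ is $$q^{\mathrm{rk}(M)}\,T_M(1-1/q,\,1).$$
   Context: Totally unimodular means every square submatrix has determinant in $\{0,\pm1\}$. $M$ is the matroid of linear independence of the columns of $A$, and $\mathrm{rk}(M)=r$. $Z_A=\{\sum_{i=1}^m c_iv_i:0\le c_i\le1\}\subset\mathbb{R}^r$, where $v_1,\dots,v_m$ are the columns of $A$; $qZ_A$ is its $q$-th dilate. Lattice points are points of $\mathbb{Z}^r$, and interior lattice points are those in the topological interior of $qZ_A$ in $\mathbb{R}^r$. $T_M(x,y)$ is the Tutte polynomial of $M$, $T_M(x,y)=\sum_{S\subseteq E}(x-1)^{\mathrm{rk}(M)-\mathrm{rk}(S)}(y-1)^{|S|-\mathrm{rk}(S)}$. *)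

theory Defs
  imports "HOL-Analysis.Analysis" "Jordan_Normal_Form.Determinant"
begin

hide_const (open) Matrix.mat Matrix.row Matrix.col Determinant.det Matrix.rows
no_notation vec_index (infixl \<open>$\<close> 100)

text \<open>
  An \<open>r \<times> m\<close> real matrix is an element of \<open>real^'m^'r\<close>, with rows indexed by \<open>'r\<close> and
  columns indexed by \<open>'m\<close>.  The order of a square submatrix is not determined by a type, so
  its determinant is taken in the carrier-based matrix library.  The chosen rows and columns are
  listed by injections \<open>f\<close> and \<open>g\<close> because finite index types carry no order; another listing of
  the same rows and columns changes the determinant at most by a sign.
\<close>

definition totally_unimodular :: "real^'m^'r \<Rightarrow> bool" where
  "totally_unimodular A \<longleftrightarrow>
     (\<forall>(k::nat) f g. inj_on f {..<k} \<and> inj_on g {..<k} \<longrightarrow>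
        Determinant.det (Matrix.mat k k (\<lambda>(i, j). A $ f i $ g j)) \<in> {-1, 0, 1})"

type_synonym 'a matroid = "'a set \<times> 'a set set"

definition ground :: "'a matroid \<Rightarrow> 'a set" where
  "ground M = fst M"

definition indep_sets :: "'a matroid \<Rightarrow> 'a set set" where
  "indep_sets M = snd M"

definition is_matroid :: "'a matroid \<Rightarrow> bool" where
  "is_matroid M \<longleftrightarrow>
     finite (ground M) \<and> indep_sets M \<subseteq> Pow (ground M) \<and> {} \<in> indep_sets M \<and>
     (\<forall>I J. J \<in> indep_sets M \<and> I \<subseteq> J \<longrightarrow> I \<in> indep_sets M) \<and>
     (\<forall>I J. I \<in> indep_sets M \<and> J \<in> indep_sets M \<and> card I < card J \<longrightarrow>
        (\<exists>e\<in>J - I. insert e I \<in> indep_sets M))"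

definition rk :: "'a matroid \<Rightarrow> 'a set \<Rightarrow> nat" where
  "rk M S = Max (card ` {I \<in> indep_sets M. I \<subseteq> S})"

text \<open>
  The exponents are natural-number subtractions, which do not truncate since
  \<open>rk M S \<le> rk M (ground M)\<close> and \<open>rk M S \<le> card S\<close>.  As for the
  evaluation of a polynomial, \<open>0 ^ 0 = 1\<close>.
\<close>

definition tutte :: "'a matroid \<Rightarrow> 'b::comm_ring_1 \<Rightarrow> 'b \<Rightarrow> 'b" where
  "tutte M x y =
     (\<Sum>S\<in>Pow (ground M). (x - 1) ^ (rk M (ground M) - rk M S) * (y - 1) ^ (card S - rk M S))"

text \<open>
  Linear independence of the columns as a family: the injectivity condition makes
  a pair of equal columns dependent.
\<close>

definition column_matroid :: "real^'m^'r \<Rightarrow> 'm matroid" where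
  "column_matroid A =
     (UNIV, {S. inj_on (\<lambda>j. column j A) S \<and> independent ((\<lambda>j. column j A) ` S)})"

definition zonotope :: "real^'m^'r \<Rightarrow> (real^'r) set" where
  "zonotope A = {\<Sum>j\<in>UNIV. c j *\<^sub>R column j A | c. \<forall>j. 0 \<le> c j \<and> c j \<le> 1}"

definition dilate :: "nat \<Rightarrow> 'a::real_vector set \<Rightarrow> 'a set" where
  "dilate q S = (\<lambda>x. real q *\<^sub>R x) ` S"

definition lattice_points :: "(real^'r) set" where
  "lattice_points = {x. \<forall>i. x $ i \<in> \<int>}"

lemma is_matroid_column_matroid: "is_matroid (column_matroid A)"
proof -
  let ?c = "\<lambda>j. column j A"
  let ?P = "\<lambda>S. inj_on ?c S \<and> independent (?c ` S)"
  have aug: "\<exists>e\<in>J - I. inj_on ?c (insert e I) \<and> independent (?c ` insert e I)"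
    if I: "inj_on ?c I" "independent (?c ` I)" and J: "inj_on ?c J" "independent (?c ` J)"
      and less: "card I < card J" for I J
  proof -
    have "\<not> ?c ` J \<subseteq> span (?c ` I)"
    proof
      assume "?c ` J \<subseteq> span (?c ` I)"
      then have "card (?c ` J) \<le> card (?c ` I)"
        using independent_span_bound[OF _ J(2)] by simp
      with less I(1) J(1) show False
        by (simp add: card_image)
    qed
    then obtain e where e: "e \<in> J" "?c e \<notin> span (?c ` I)"
      by (auto simp only: image_subset_iff)
    have notin: "?c e \<notin> ?c ` I"
      using e(2) span_base[of "?c e" "?c ` I"] by argo
    then have "e \<notin> I"
      by (auto simp only: image_iff)
    moreover have "inj_on ?c (insert e I)"
      using I(1) notin \<open>e \<notin> I\<close> by simp
    moreover have "independent (?c ` insert e I)"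
      using I(2) e(2) notin by (simp add: independent_insert)
    ultimately show ?thesis
      using e(1) by blast
  qed
  have hereditary: "inj_on ?c I \<and> independent (?c ` I)"
    if "inj_on ?c J" "independent (?c ` J)" "I \<subseteq> J" for I J
    using inj_on_subset[OF that(1,3)] independent_mono[OF that(2) image_mono[OF that(3)]] by simp
  have "\<forall>I J. ?P J \<and> I \<subseteq> J \<longrightarrow> ?P I"
    by (intro allI impI, elim conjE) (rule hereditary)
  moreover have "\<forall>I J. ?P I \<and> ?P J \<and> card I < card J \<longrightarrow> (\<exists>e\<in>J - I. ?P (insert e I))"
    by (intro allI impI, elim conjE) (rule aug)
  moreover have "inj_on ?c {}" "independent (?c ` {})"
    by (simp_all add: independent_empty)
  ultimately show ?thesis
    unfolding is_matroid_def column_matroid_def ground_def indep_sets_def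
      fst_conv snd_conv mem_Collect_eq Pow_UNIV
    by (intro conjI) (assumption | rule finite subset_UNIV)+
qed

text \<open>Hence \<^const>\<open>card\<close> does count the lattice points in \<open>qZ\<close> and in its interior.\<close>

lemma finite_lattice_points_dilate_zonotope:
  fixes A :: "real^'m^'r"
  shows "finite (dilate q (zonotope A) \<inter> lattice_points)"
proof -
  define B where "B = real q * (\<Sum>i\<in>UNIV. \<Sum>j\<in>UNIV. \<bar>A $ i $ j\<bar>)"
  let ?V = "{k::real. k \<in> \<int> \<and> \<bar>k\<bar> \<le> B}"
  have bound: "\<bar>x $ i\<bar> \<le> B" if "x \<in> dilate q (zonotope A)" for x i
  proof -
    obtain c where x: "x = real q *\<^sub>R (\<Sum>j\<in>UNIV. c j *\<^sub>R column j A)"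
      and c: "\<And>j. 0 \<le> c j \<and> c j \<le> 1"
      using \<open>x \<in> dilate q (zonotope A)\<close> unfolding dilate_def zonotope_def by blast
    have "\<bar>\<Sum>j\<in>UNIV. c j * A $ i $ j\<bar> \<le> (\<Sum>j\<in>UNIV. \<bar>c j * A $ i $ j\<bar>)"
      by (rule sum_abs)
    also have "\<dots> \<le> (\<Sum>j\<in>UNIV. \<bar>A $ i $ j\<bar>)"
      using c by (intro sum_mono) (simp add: abs_mult mult_left_le_one_le)
    also have "\<dots> \<le> (\<Sum>i\<in>UNIV. \<Sum>j\<in>UNIV. \<bar>A $ i $ j\<bar>)"
      by (rule member_le_sum) (auto intro: sum_nonneg)
    finally show ?thesis
      by (simp add: x B_def column_def abs_mult mult_left_mono)
  qed
  have "finite ?V"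
    by (rule finite_abs_int_segment)
  then have "finite {f. \<forall>i::'r. f i \<in> ?V}"
    using finite_set_of_finite_funs[of "UNIV::'r set" ?V] by simp
  then have "finite (vec_lambda ` {f. \<forall>i::'r. f i \<in> ?V})"
    by (rule finite_imageI)
  moreover have "dilate q (zonotope A) \<inter> lattice_points \<subseteq> vec_lambda ` {f. \<forall>i::'r. f i \<in> ?V}"
  proof
    fix x assume "x \<in> dilate q (zonotope A) \<inter> lattice_points"
    then have "\<forall>i. x $ i \<in> ?V"
      using bound by (auto simp: lattice_points_def)
    then show "x \<in> vec_lambda ` {f. \<forall>i::'r. f i \<in> ?V}"
      by (intro image_eqI[of _ _ "vec_nth x"]) (simp_all add: vec_nth_inverse)
  qed
  ultimately show ?thesis
    by (rule finite_subset[rotated])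
qed

end

theory Submission
  imports Defs
begin

text \<open>
  At \<open>y = 1\<close> the Tutte polynomial only sees independent sets, and the claimed number is
  \<open>\<Sum>\<^sub>I (-1)\<^bsup>r - |I|\<^esup> q\<^bsup>|I|\<^esup>\<close> over the independent sets \<open>I\<close> of columns
  (\<open>tutte_column_matroid_at_one\<close>). The interior of \<open>qZ\<^sub>A\<close> is the set of combinations of columns with
  coefficients strictly between \<open>0\<close> and \<open>q\<close> (\<open>interior_dilate_zonotope\<close>), so it is to be shown that
  the signed sum counts the lattice points of this shape.

  This is proved by deletion and contraction of a nonzero vector \<open>v m\<close>. Contraction is the projection
  along \<open>v m\<close>, applied to the lattice as well as to the other vectors. Each lattice line in
  direction \<open>v m\<close> meets the open zonotope of the other vectors either not at all, or in an open
  interval of positive length, or (if \<open>v m\<close> is not in their span) in one point. The heart of the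
  matter is that the ends of the interval, or the point, are lattice points
  (\<open>line_meets_open_zonotope_in_interval\<close>). Adding \<open>v m\<close> to the family prolongs the interval by \<open>q\<close>
  steps. Hence each line that meets the zonotope gains \<open>q\<close> lattice points, or ends up with \<open>q - 1\<close>
  in the case of a single point. The number of these lines is the number of points for the
  contraction (\<open>card_open_zonotope_insert\<close>), and the signed sum satisfies the same recursion
  (\<open>card_lattice_points_open_zonotope\<close>).

  The integrality comes from total unimodularity in the form of \<open>unimodular_family\<close>: the coefficients
  of a lattice point with respect to an independent subfamily are integers. It follows from
  Cramer's rule (\<open>totally_unimodular_imp_unimodular_family\<close>), is inherited by contractions
  (\<open>unimodular_family_contract\<close>), and implies that the coefficients of a lattice point can be rounded
  without moving the point (\<open>unimodular_rounding\<close>).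
\<close>

section \<open>Linearly independent families\<close>

text \<open>
Columns can repeat, so independence is needed for families; independence of the set of members
would not see a repetition.
\<close>

definition lin_indep :: "('b \<Rightarrow> 'a::euclidean_space) \<Rightarrow> 'b set \<Rightarrow> bool" where
  "lin_indep v F \<longleftrightarrow> (\<forall>c. (\<Sum>j\<in>F. c j *\<^sub>R v j) = 0 \<longrightarrow> (\<forall>j\<in>F. c j = 0))"

lemma lin_indep_iff_independent_image:
  assumes "finite F"
  shows "lin_indep v F \<longleftrightarrow> inj_on v F \<and> independent (v ` F)"
proof
  assume indep: "lin_indep v F"
  have inj: "inj_on v F"
  proof (rule inj_onI, rule ccontr)
    fix i j assume ij: "i \<in> F" "j \<in> F" "v i = v j" "i \<noteq> j"
    define c where "c k = (if k = i then 1 else if k = j then -1 else 0 :: real)" for k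
    have "(\<Sum>k\<in>F. c k *\<^sub>R v k) = (\<Sum>k\<in>{i, j}. c k *\<^sub>R v k)"
      using ij assms by (intro sum.mono_neutral_right) (auto simp: c_def)
    also have "\<dots> = 0"
      using ij by (simp add: c_def)
    finally have "c i = 0"
      using indep ij(1) unfolding lin_indep_def by blast
    then show False by (simp add: c_def)
  qed
  moreover have "independent (v ` F)"
  proof (rule independent_if_scalars_zero)
    fix f x assume "(\<Sum>x\<in>v ` F. f x *\<^sub>R x) = 0" "x \<in> v ` F"
    then show "f x = 0"
      using indep inj unfolding lin_indep_def by (auto simp: sum.reindex)
  qed (use assms in simp)
  ultimately show "inj_on v F \<and> independent (v ` F)" by blast
next
  assume *: "inj_on v F \<and> independent (v ` F)"
  show "lin_indep v F"
    unfolding lin_indep_def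
  proof (intro allI impI ballI)
    fix c j assume c: "(\<Sum>j\<in>F. c j *\<^sub>R v j) = 0" and j: "j \<in> F"
    have "(\<Sum>x\<in>v ` F. c (the_inv_into F v x) *\<^sub>R x) = (\<Sum>j\<in>F. c j *\<^sub>R v j)"
      using * by (simp add: sum.reindex the_inv_into_f_f)
    then have "c (the_inv_into F v (v j)) = 0"
      using * c j assms independentD[of "v ` F" "v ` F" "\<lambda>x. c (the_inv_into F v x)" "v j"] by auto
    then show "c j = 0"
      using * j by (simp add: the_inv_into_f_f)
  qed
qed

lemma lin_indep_insert_notin_span:
  assumes "finite F" "v m \<notin> span (v ` F)" 
  shows "lin_indep v (insert m F) \<longleftrightarrow> lin_indep v F"
proof -
  have [simp]: "v m \<notin> v ` F"
    using assms(2) span_base[of "v m" "v ` F"] by argo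
  then have "m \<notin> F" by (auto simp only: image_iff)
  then show ?thesis
    using assms by (simp add: lin_indep_iff_independent_image independent_insert)
qed

lemma not_lin_indep_zero:
  assumes "finite F" "v m = 0" "m \<in> F"
  shows "\<not> lin_indep v F"
  using assms dependent_zero[of "v ` F"] by (auto simp: lin_indep_iff_independent_image image_iff)

lemma sum_linear_image:
  assumes "linear f"
  shows "f (\<Sum>j\<in>F. c j *\<^sub>R v j) = (\<Sum>j\<in>F. c j *\<^sub>R f (v j))"
  using assms by (simp add: linear_sum linear_scale)

section \<open>Contraction\<close>

text \<open>
The orthogonal projection stands in for the quotient by the line through \<open>u\<close>: its
kernel is that line, and it maps the space to itself, so contracting a vector does not
change the type of the ambient space.
\<close>

definition project_along :: "'a::euclidean_space \<Rightarrow> 'a \<Rightarrow> 'a" where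
  "project_along u x = x - ((x \<bullet> u) / (u \<bullet> u)) *\<^sub>R u"

lemma linear_project_along: "linear (project_along u)"
  unfolding project_along_def by (rule linearI) (simp_all add: algebra_simps add_divide_distrib)

lemma project_along_self [simp]: "project_along u u = 0"
  by (simp add: project_along_def)

lemma project_along_eq_0D: "project_along u x = 0 \<Longrightarrow> \<exists>t. x = t *\<^sub>R u"
  by (auto simp: project_along_def)

lemma project_along_inner_eq_0: "project_along u x \<bullet> u = 0"
  by (cases "u = 0") (simp_all add: project_along_def inner_diff_left)

text \<open>
The independent sets of the contraction of \<open>m\<close> are those of the projected family: a relation
among the projections is a relation among the vectors modulo a multiple of \<open>v m\<close>.
\<close>

lemma lin_indep_insert_iff_project:
  assumes F: "finite F" "m \<notin> F" and "v m \<noteq> 0"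
  shows "lin_indep v (insert m F) \<longleftrightarrow> lin_indep (\<lambda>j. project_along (v m) (v j)) F"
    (is "?L \<longleftrightarrow> lin_indep ?w F")
proof
  assume L: ?L
  show "lin_indep ?w F"
    unfolding lin_indep_def
  proof (intro allI impI)
    fix c assume "(\<Sum>j\<in>F. c j *\<^sub>R ?w j) = 0"
    then have "project_along (v m) (\<Sum>j\<in>F. c j *\<^sub>R v j) = 0"
      by (simp add: sum_linear_image[OF linear_project_along])
    then obtain t where t: "(\<Sum>j\<in>F. c j *\<^sub>R v j) = t *\<^sub>R v m"
      using project_along_eq_0D by blast
    have "(\<Sum>j\<in>F. (c(m := - t)) j *\<^sub>R v j) = (\<Sum>j\<in>F. c j *\<^sub>R v j)"
      using F by (intro sum.cong) auto
    then have "(\<Sum>j\<in>insert m F. (c(m := - t)) j *\<^sub>R v j) = 0"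
      using F t by simp
    then have "\<forall>j\<in>insert m F. (c(m := - t)) j = 0"
      using L unfolding lin_indep_def by blast
    then show "\<forall>j\<in>F. c j = 0"
      using F by (metis fun_upd_other insertCI)
  qed
next
  assume R: "lin_indep ?w F"
  show ?L
    unfolding lin_indep_def
  proof (intro allI impI)
    fix c assume c: "(\<Sum>j\<in>insert m F. c j *\<^sub>R v j) = 0"
    then have "project_along (v m) (\<Sum>j\<in>insert m F. c j *\<^sub>R v j) = 0"
      by (simp add: linear_0[OF linear_project_along])
    then have "(\<Sum>j\<in>F. c j *\<^sub>R ?w j) = 0"
      using F by (simp add: sum_linear_image[OF linear_project_along] linear_add[OF linear_project_along]
          linear_scale[OF linear_project_along])
    then have z: "\<forall>j\<in>F. c j = 0"
      using R unfolding lin_indep_def by blast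
    then have "c m *\<^sub>R v m = 0"
      using c F by simp
    then show "\<forall>j\<in>insert m F. c j = 0"
      using z assms(3) by simp
  qed
qed

text \<open>
Subtracting multiples of \<open>v m\<close> does not change the span, and the projected vectors are
orthogonal to \<open>v m\<close>, so the dimensions add up.
\<close>

lemma dim_insert_project:
  assumes "v m \<noteq> 0"
  shows "dim (v ` insert m E) = Suc (dim ((\<lambda>j. project_along (v m) (v j)) ` E))"
proof -
  let ?p = "project_along (v m)"
  let ?P = "(\<lambda>j. ?p (v j)) ` E"
  have "span (v ` insert m E) = span ({v m} \<union> ?P)"
  proof (rule span_eq[THEN iffD2], intro conjI subsetI)
    fix x assume "x \<in> v ` insert m E"
    then consider "x = v m" | j where "j \<in> E" "x = v j" by auto
    then show "x \<in> span ({v m} \<union> ?P)"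
    proof cases
      case 2
      have "x = ?p x + ((x \<bullet> v m) / (v m \<bullet> v m)) *\<^sub>R v m"
        by (simp add: project_along_def)
      also have "\<dots> \<in> span ({v m} \<union> ?P)"
        using 2 by (intro span_add span_scale span_base) auto
      finally show ?thesis .
    qed (simp add: span_base)
  next
    fix x assume "x \<in> {v m} \<union> ?P"
    then consider "x = v m" | j where "j \<in> E" "x = ?p (v j)" by auto
    then show "x \<in> span (v ` insert m E)"
    proof cases
      case 2
      then show ?thesis
        unfolding 2(2) project_along_def by (intro span_diff span_scale span_base) (use 2(1) in auto)
    qed (simp add: span_base)
  qed
  then have "dim (v ` insert m E) = dim ({v m} \<union> ?P)"
    by (metis dim_span)
  also have "\<dots> = dim {v m} + dim ?P"
    by (rule dim_orthogonal_sum) (auto simp: project_along_inner_eq_0 inner_commute[of "v m"])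
  also have "dim {v m} = 1"
    using assms dim_eq_card_independent[of "{v m}"] by simp
  finally show ?thesis by simp
qed

section \<open>Unimodular families\<close>

text \<open>
A form of unimodularity relative to a subgroup \<open>L\<close> that stands for the lattice. Unlike a
condition on minors, it mentions no coordinates and therefore passes to projections of the family
together with the lattice.
\<close>

definition unimodular_family :: "'a::euclidean_space set \<Rightarrow> 'b set \<Rightarrow> ('b \<Rightarrow> 'a) \<Rightarrow> bool" where
  "unimodular_family L E v \<longleftrightarrow>
     0 \<in> L \<and> (\<forall>x\<in>L. \<forall>y\<in>L. x - y \<in> L) \<and> v ` E \<subseteq> L \<and>
     (\<forall>F c. F \<subseteq> E \<and> lin_indep v F \<and> (\<Sum>j\<in>F. c j *\<^sub>R v j) \<in> L \<longrightarrow> (\<forall>j\<in>F. c j \<in> \<int>))"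

context
  fixes L :: "'a::euclidean_space set" and E :: "'b set" and v
  assumes uni: "unimodular_family L E v"
begin

lemma unimodular_familyD:
  assumes "F \<subseteq> E" "lin_indep v F" "(\<Sum>j\<in>F. c j *\<^sub>R v j) \<in> L" "j \<in> F"
  shows "c j \<in> \<int>"
  using uni assms unfolding unimodular_family_def by blast

lemma zero_in_lattice: "0 \<in> L" and vector_in_lattice: "j \<in> E \<Longrightarrow> v j \<in> L"
  and diff_in_lattice: "x \<in> L \<Longrightarrow> y \<in> L \<Longrightarrow> x - y \<in> L"
  using uni unfolding unimodular_family_def by auto

lemma add_in_lattice: "x \<in> L \<Longrightarrow> y \<in> L \<Longrightarrow> x + y \<in> L"
  using diff_in_lattice[of x "0 - y"] diff_in_lattice[of 0 y] zero_in_lattice by simp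

lemma nat_multiple_in_lattice: "x \<in> L \<Longrightarrow> real n *\<^sub>R x \<in> L"
  by (induction n) (auto simp: zero_in_lattice algebra_simps intro: add_in_lattice)

lemma Ints_multiple_in_lattice:
  assumes "x \<in> L" "k \<in> \<int>"
  shows "k *\<^sub>R x \<in> L"
proof -
  obtain i where i: "k = of_int i" using assms(2) Ints_cases by blast
  show ?thesis
  proof (cases i rule: int_cases2)
    case (nonneg n)
    then show ?thesis using i nat_multiple_in_lattice[OF assms(1)] by simp
  next
    case (nonpos n)
    then show ?thesis
      using i diff_in_lattice[OF zero_in_lattice nat_multiple_in_lattice[OF assms(1), of n]] by simp
  qed
qed

lemma Ints_combination_in_lattice:
  assumes "F \<subseteq> E" "\<And>j. j \<in> F \<Longrightarrow> c j \<in> \<int>"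
  shows "(\<Sum>j\<in>F. c j *\<^sub>R v j) \<in> L"
  using assms
  by (induction F rule: infinite_finite_induct)
    (auto simp: zero_in_lattice intro!: add_in_lattice Ints_multiple_in_lattice vector_in_lattice)

end

lemma unimodular_family_subset: "unimodular_family L E v \<Longrightarrow> E' \<subseteq> E \<Longrightarrow> unimodular_family L E' v"
  unfolding unimodular_family_def by (meson image_mono subset_trans)

text \<open>
A representation of a projected lattice point by an independent projected family lifts, with a
suitable coefficient at \<open>m\<close>, to one of the lattice point itself, by the independent family
with \<open>m\<close> added.
\<close>

lemma unimodular_family_contract:
  assumes uni: "unimodular_family L (insert m E) v" and E: "finite E" "m \<notin> E" and "v m \<noteq> 0"
  shows "unimodular_family (project_along (v m) ` L) E (\<lambda>j. project_along (v m) (v j))"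
    (is "unimodular_family (?p ` L) E ?w")
proof -
  note lin = linear_project_along[of "v m"]
  have "c j \<in> \<int>"
    if F: "F \<subseteq> E" "lin_indep ?w F" and cL: "(\<Sum>j\<in>F. c j *\<^sub>R ?w j) \<in> ?p ` L" and j: "j \<in> F" for F c j
  proof -
    have fin: "finite F" "m \<notin> F" using F E finite_subset by auto
    obtain x where x: "x \<in> L" "(\<Sum>j\<in>F. c j *\<^sub>R ?w j) = ?p x" using cL by blast
    then have "?p (x - (\<Sum>j\<in>F. c j *\<^sub>R v j)) = 0"
      by (simp add: linear_diff[OF lin] sum_linear_image[OF lin])
    then obtain t where t: "x - (\<Sum>j\<in>F. c j *\<^sub>R v j) = t *\<^sub>R v m"
      using project_along_eq_0D by blast
    have "(\<Sum>j\<in>F. (c(m := t)) j *\<^sub>R v j) = (\<Sum>j\<in>F. c j *\<^sub>R v j)"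
      using fin by (intro sum.cong) auto
    then have "(\<Sum>j\<in>insert m F. (c(m := t)) j *\<^sub>R v j) = x"
      using fin t by (simp add: algebra_simps)
    then have "(c(m := t)) j \<in> \<int>"
      using lin_indep_insert_iff_project[of F m v] fin assms(4) F x(1) j
      by (intro unimodular_familyD[OF uni, of "insert m F"]) auto
    then show ?thesis using j fin by (metis fun_upd_other)
  qed
  moreover have "0 \<in> ?p ` L"
    using zero_in_lattice[OF uni] linear_0[OF lin] by (metis imageI)
  moreover have "x - y \<in> ?p ` L" if "x \<in> ?p ` L" "y \<in> ?p ` L" for x y
    using that diff_in_lattice[OF uni] by (auto simp flip: linear_diff[OF lin])
  moreover have "?w ` E \<subseteq> ?p ` L"
    using vector_in_lattice[OF uni] by auto
  ultimately show ?thesis unfolding unimodular_family_def by blast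
qed

text \<open>
Integrality of the linear program with constraints \<open>\<lfloor>c\<rfloor> \<le> c' \<le> \<lceil>c\<rceil>\<close> and objective \<open>\<sigma> c'\<^sub>m\<close>.
As long as some coefficients are not integers, the vectors carrying them are dependent by
unimodularity. Moving \<open>c\<close> along a relation between them, in the direction that does not decrease
the objective, keeps the point fixed until a further coefficient becomes an integer. The sign
\<open>\<sigma>\<close> allows rounding the coefficient at \<open>m\<close> upwards or downwards as desired.
\<close>

lemma unimodular_rounding:
  assumes uni: "unimodular_family L D v" and D: "finite D"
    and x: "(\<Sum>j\<in>D. c j *\<^sub>R v j) \<in> L"
  shows "\<exists>c'. (\<forall>j\<in>D. c' j \<in> \<int> \<and> of_int \<lfloor>c j\<rfloor> \<le> c' j \<and> c' j \<le> of_int \<lceil>c j\<rceil>) \<and>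
    (\<Sum>j\<in>D. c' j *\<^sub>R v j) = (\<Sum>j\<in>D. c j *\<^sub>R v j) \<and> \<sigma> * c m \<le> \<sigma> * (c' m :: real)"
  using x
proof (induction "card {j\<in>D. c j \<notin> \<int>}" arbitrary: c rule: less_induct)
  case less
  let ?F = "{j\<in>D. c j \<notin> \<int>}"
  have fin: "finite ?F" using D by simp
  show ?case
  proof (cases "?F = {}")
    case True
    then have "\<forall>j\<in>D. c j \<in> \<int>" by blast
    then show ?thesis by (intro exI[of _ c]) auto
  next
    case False
    have split: "(\<Sum>j\<in>D. c j *\<^sub>R v j) = (\<Sum>j\<in>?F. c j *\<^sub>R v j) + (\<Sum>j\<in>D - ?F. c j *\<^sub>R v j)"
      using D by (subst sum.subset_diff[of ?F D]) (auto simp: add.commute)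
    have "(\<Sum>j\<in>D - ?F. c j *\<^sub>R v j) \<in> L"
      by (rule Ints_combination_in_lattice[OF uni]) auto
    from diff_in_lattice[OF uni less.prems this] have "(\<Sum>j\<in>?F. c j *\<^sub>R v j) \<in> L"
      unfolding split by (simp only: add_diff_cancel_right')
    then have "\<not> lin_indep v ?F"
      using unimodular_familyD[OF uni, of ?F c] False by blast
    then obtain d0 j0 where d0: "(\<Sum>j\<in>?F. d0 j *\<^sub>R v j) = 0" "j0 \<in> ?F" "d0 j0 \<noteq> 0"
      unfolding lin_indep_def by blast
    \<comment> \<open>The relation is extended by zero and oriented so that it does not decrease the objective.\<close>
    define e where "e j = (if j \<in> ?F then d0 j else 0)" for j
    define d where "d j = (if \<sigma> * e m \<ge> 0 then e j else - e j)" for j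
    have "(\<Sum>j\<in>D. e j *\<^sub>R v j) = (\<Sum>j\<in>?F. e j *\<^sub>R v j)"
      using D by (intro sum.mono_neutral_right) (auto simp: e_def)
    also have "\<dots> = (\<Sum>j\<in>?F. d0 j *\<^sub>R v j)"
      by (intro sum.cong) (auto simp: e_def)
    finally have esum: "(\<Sum>j\<in>D. e j *\<^sub>R v j) = 0" using d0(1) by simp
    have dsum: "(\<Sum>j\<in>D. d j *\<^sub>R v j) = 0"
      using esum by (cases "\<sigma> * e m \<ge> 0") (simp_all add: d_def sum_negf)
    have dm: "\<sigma> * d m \<ge> 0" by (simp add: d_def)
    have dj0: "j0 \<in> ?F" "d j0 \<noteq> 0" using d0 by (simp_all add: d_def e_def)
    have dout: "d j = 0" if "j \<notin> ?F" for j using that by (auto simp: d_def e_def)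
    define S where "S = {j\<in>?F. d j \<noteq> 0}"
    \<comment> \<open>The step length at which the \<open>j\<close>-th coefficient reaches its rounding.\<close>
    define \<tau> where "\<tau> j = (if d j > 0 then (of_int \<lceil>c j\<rceil> - c j) / d j else (c j - of_int \<lfloor>c j\<rfloor>) / (- d j))" for j
    define \<mu> where "\<mu> = Min (\<tau> ` S)"
    have S: "finite S" "S \<noteq> {}" using dj0 by (auto simp: S_def D)
    then have "\<mu> \<in> \<tau> ` S" unfolding \<mu>_def by (intro Min_in) auto
    then obtain k where k: "k \<in> S" "\<mu> = \<tau> k" by blast
    have \<mu>le: "\<mu> \<le> \<tau> j" if "j \<in> S" for j using S that by (simp add: \<mu>_def)
    have "\<tau> k \<ge> 0"
      unfolding \<tau>_def by (auto intro!: divide_nonneg_nonneg divide_nonneg_nonpos simp: le_of_int_ceiling)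
    then have \<mu>0: "\<mu> \<ge> 0" using k by simp
    define b where "b j = c j + \<mu> * d j" for j
    have box: "of_int \<lfloor>c j\<rfloor> \<le> b j \<and> b j \<le> of_int \<lceil>c j\<rceil>" if "j \<in> D" for j
    proof (cases "j \<in> S")
      case False
      then have "d j = 0" using dout[of j] that by (auto simp: S_def)
      then show ?thesis by (simp add: b_def)
    next
      case True
      then have le: "\<mu> \<le> \<tau> j" by (rule \<mu>le)
      show ?thesis
      proof (cases "d j > 0")
        case True
        then have "\<mu> * d j \<le> of_int \<lceil>c j\<rceil> - c j" using le by (simp add: \<tau>_def pos_le_divide_eq)
        moreover have "\<mu> * d j \<ge> 0" using \<mu>0 True by simp
        ultimately show ?thesis unfolding b_def using of_int_floor_le[of "c j"] by linarith
      next
        case F: False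
        then have neg: "d j < 0" using True by (auto simp: S_def)
        then have "\<mu> \<le> (c j - of_int \<lfloor>c j\<rfloor>) / (- d j)" using le F unfolding \<tau>_def by argo
        then have "\<mu> * (- d j) \<le> c j - of_int \<lfloor>c j\<rfloor>" using neg by (subst (asm) pos_le_divide_eq) auto
        moreover have "\<mu> * (- d j) \<ge> 0" using \<mu>0 neg by (intro mult_nonneg_nonneg) auto
        ultimately show ?thesis unfolding b_def using le_of_int_ceiling[of "c j"] by linarith
      qed
    qed
    have bk: "b k \<in> \<int>"
    proof (cases "d k > 0")
      case True
      then have "b k = of_int \<lceil>c k\<rceil>" by (simp add: b_def k \<tau>_def)
      then show ?thesis by simp
    next
      case False
      then have "d k < 0" using k by (auto simp: S_def)
      then have "b k = of_int \<lfloor>c k\<rfloor>" by (simp add: b_def k \<tau>_def field_simps)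
      then show ?thesis by simp
    qed
    have bint: "b j = c j" if "c j \<in> \<int>" for j
      using dout[of j] that by (simp add: b_def)
    have "{j\<in>D. b j \<notin> \<int>} \<subseteq> ?F - {k}"
      using bk bint by auto
    then have "{j\<in>D. b j \<notin> \<int>} \<subset> ?F" using k by (auto simp: S_def)
    then have card: "card {j\<in>D. b j \<notin> \<int>} < card ?F" using fin by (rule psubset_card_mono[rotated])
    have bsum: "(\<Sum>j\<in>D. b j *\<^sub>R v j) = (\<Sum>j\<in>D. c j *\<^sub>R v j)"
    proof -
      have "(\<Sum>j\<in>D. b j *\<^sub>R v j) = (\<Sum>j\<in>D. c j *\<^sub>R v j) + \<mu> *\<^sub>R (\<Sum>j\<in>D. d j *\<^sub>R v j)"
        by (simp add: b_def scaleR_left_distrib sum.distrib scaleR_right.sum)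
      then show ?thesis using dsum by simp
    qed
    have bL: "(\<Sum>j\<in>D. b j *\<^sub>R v j) \<in> L"
      unfolding bsum by (rule less.prems)
    from less.hyps[OF card bL]
    obtain c' where c': "\<forall>j\<in>D. c' j \<in> \<int> \<and> of_int \<lfloor>b j\<rfloor> \<le> c' j \<and> c' j \<le> of_int \<lceil>b j\<rceil>"
      "(\<Sum>j\<in>D. c' j *\<^sub>R v j) = (\<Sum>j\<in>D. b j *\<^sub>R v j)" "\<sigma> * b m \<le> \<sigma> * c' m"
      by (elim exE conjE) (rule that)
    have "of_int \<lfloor>c j\<rfloor> \<le> c' j \<and> c' j \<le> of_int \<lceil>c j\<rceil>" if "j \<in> D" for j
    proof -
      have "\<lfloor>c j\<rfloor> \<le> \<lfloor>b j\<rfloor>" "\<lceil>b j\<rceil> \<le> \<lceil>c j\<rceil>"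
        using box[OF that] by (simp_all add: le_floor_iff ceiling_le_iff)
      then have "real_of_int \<lfloor>c j\<rfloor> \<le> of_int \<lfloor>b j\<rfloor>" "real_of_int \<lceil>b j\<rceil> \<le> of_int \<lceil>c j\<rceil>" by simp_all
      moreover have "of_int \<lfloor>b j\<rfloor> \<le> c' j" "c' j \<le> of_int \<lceil>b j\<rceil>" using c'(1) that by blast+
      ultimately show ?thesis by linarith
    qed
    moreover have "\<sigma> * c m \<le> \<sigma> * b m"
    proof -
      have "\<mu> * (\<sigma> * d m) \<ge> 0" using \<mu>0 dm by simp
      then show ?thesis by (simp add: b_def algebra_simps)
    qed
    moreover have "\<forall>j\<in>D. c' j \<in> \<int>" using c'(1) by blast
    ultimately show ?thesis
      using c'(2,3) unfolding bsum by (intro exI[of _ c'] conjI ballI) (assumption | blast | linarith)+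
  qed
qed

section \<open>Open zonotopes and their lines\<close>

text \<open>
This is the relative interior of the dilated zonotope. The topological interior is empty if the
vectors do not span the space, as happens after a projection, while the count of this set obeys
one formula in every rank.
\<close>

definition open_zonotope :: "('b \<Rightarrow> 'a::euclidean_space) \<Rightarrow> real \<Rightarrow> 'b set \<Rightarrow> 'a set" where
  "open_zonotope v q E = {\<Sum>j\<in>E. c j *\<^sub>R v j | c. \<forall>j\<in>E. 0 < c j \<and> c j < q}"

lemma open_zonotope_insert:
  assumes "finite E" "m \<notin> E"
  shows "y \<in> open_zonotope v q (insert m E) \<longleftrightarrow> (\<exists>t. 0 < t \<and> t < q \<and> y - t *\<^sub>R v m \<in> open_zonotope v q E)"
proof
  assume "y \<in> open_zonotope v q (insert m E)"
  then obtain c where c: "\<forall>j\<in>insert m E. 0 < c j \<and> c j < q" "y = (\<Sum>j\<in>insert m E. c j *\<^sub>R v j)"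
    unfolding open_zonotope_def by blast
  then have "y - c m *\<^sub>R v m = (\<Sum>j\<in>E. c j *\<^sub>R v j)" using assms by simp
  then show "\<exists>t. 0 < t \<and> t < q \<and> y - t *\<^sub>R v m \<in> open_zonotope v q E"
    using c(1) unfolding open_zonotope_def by blast
next
  assume "\<exists>t. 0 < t \<and> t < q \<and> y - t *\<^sub>R v m \<in> open_zonotope v q E"
  then obtain t c where t: "0 < t" "t < q"
    and c: "\<forall>j\<in>E. 0 < c j \<and> c j < q" "y - t *\<^sub>R v m = (\<Sum>j\<in>E. c j *\<^sub>R v j)"
    unfolding open_zonotope_def by blast
  have "(\<Sum>j\<in>E. (c(m := t)) j *\<^sub>R v j) = (\<Sum>j\<in>E. c j *\<^sub>R v j)"
    using assms by (intro sum.cong) auto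
  then have "(\<Sum>j\<in>insert m E. (c(m := t)) j *\<^sub>R v j) = y"
    using assms by (simp flip: c(2))
  moreover have "\<forall>j\<in>insert m E. 0 < (c(m := t)) j \<and> (c(m := t)) j < q"
    using t c(1) by auto
  ultimately show "y \<in> open_zonotope v q (insert m E)"
    unfolding open_zonotope_def by blast
qed

text \<open>
A point lies in the projected zonotope iff the line through it, in the direction of projection,
meets the zonotope. So the contraction counts the lattice lines that do.
\<close>

lemma project_in_open_zonotope_iff:
  "project_along u x \<in> open_zonotope (\<lambda>j. project_along u (v j)) q E \<longleftrightarrow>
    (\<exists>s. x + s *\<^sub>R u \<in> open_zonotope v q E)"
proof
  assume "project_along u x \<in> open_zonotope (\<lambda>j. project_along u (v j)) q E"
  then obtain c where c: "\<forall>j\<in>E. 0 < c j \<and> c j < q"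
      "project_along u x = (\<Sum>j\<in>E. c j *\<^sub>R project_along u (v j))"
    unfolding open_zonotope_def by blast
  then have "project_along u ((\<Sum>j\<in>E. c j *\<^sub>R v j) - x) = 0"
    by (simp add: linear_diff[OF linear_project_along] sum_linear_image[OF linear_project_along])
  then obtain s where "(\<Sum>j\<in>E. c j *\<^sub>R v j) - x = s *\<^sub>R u"
    using project_along_eq_0D by blast
  then have "x + s *\<^sub>R u = (\<Sum>j\<in>E. c j *\<^sub>R v j)" by (simp add: algebra_simps)
  then show "\<exists>s. x + s *\<^sub>R u \<in> open_zonotope v q E"
    using c(1) unfolding open_zonotope_def by blast
next
  assume "\<exists>s. x + s *\<^sub>R u \<in> open_zonotope v q E"
  then obtain s c where c: "\<forall>j\<in>E. 0 < c j \<and> c j < q" "x + s *\<^sub>R u = (\<Sum>j\<in>E. c j *\<^sub>R v j)"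
    unfolding open_zonotope_def by blast
  have "project_along u x = project_along u (x + s *\<^sub>R u)"
    by (simp add: linear_add[OF linear_project_along] linear_scale[OF linear_project_along])
  also have "\<dots> = (\<Sum>j\<in>E. c j *\<^sub>R project_along u (v j))"
    by (simp add: c(2) sum_linear_image[OF linear_project_along])
  finally show "project_along u x \<in> open_zonotope (\<lambda>j. project_along u (v j)) q E"
    using c(1) unfolding open_zonotope_def by blast
qed

lemma in_span_imageD:
  assumes "u \<in> span (v ` E)" "finite E"
  obtains d where "u = (\<Sum>j\<in>E. d j *\<^sub>R v j)"
proof -
  have "\<exists>d. u = (\<Sum>j\<in>E. d j *\<^sub>R v j)"
    using assms(1)
  proof (induction rule: span_induct_alt)
    case base
    show ?case by (rule exI[of _ "\<lambda>_. 0"]) simp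
  next
    case (step c x y)
    then obtain i d where i: "i \<in> E" "x = v i" and d: "y = (\<Sum>j\<in>E. d j *\<^sub>R v j)" by blast
    have "(\<Sum>j\<in>E. (d j + (if j = i then c else 0)) *\<^sub>R v j) = y + (\<Sum>j\<in>E. if j = i then c *\<^sub>R v j else 0)"
      by (simp add: d scaleR_left_distrib sum.distrib if_distrib[of "\<lambda>t. t *\<^sub>R _"] cong: if_cong)
    also have "\<dots> = c *\<^sub>R x + y" using i assms(2) by simp
    finally show ?case by metis
  qed
  then show ?thesis using that by blast
qed

text \<open>
By rounding, every lattice point has a representation with coefficients in \<open>{0..q}\<close>.
\<close>

lemma finite_lattice_points_open_zonotope:
  assumes uni: "unimodular_family L E v" and E: "finite E"
  shows "finite (L \<inter> open_zonotope v (real q) E)"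
proof (rule finite_subset)
  let ?K = "E \<rightarrow>\<^sub>E real ` {0..q}"
  show "L \<inter> open_zonotope v (real q) E \<subseteq> (\<lambda>c. \<Sum>j\<in>E. c j *\<^sub>R v j) ` ?K"
  proof
    fix x assume "x \<in> L \<inter> open_zonotope v (real q) E"
    then obtain c where c: "\<forall>j\<in>E. 0 < c j \<and> c j < real q" "(\<Sum>j\<in>E. c j *\<^sub>R v j) = x" "x \<in> L"
      unfolding open_zonotope_def by blast
    obtain c' where c': "\<forall>j\<in>E. c' j \<in> \<int> \<and> of_int \<lfloor>c j\<rfloor> \<le> c' j \<and> c' j \<le> of_int \<lceil>c j\<rceil>"
      "(\<Sum>j\<in>E. c' j *\<^sub>R v j) = x"
      using unimodular_rounding[OF uni E, of c 0] c(2,3) by auto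
    have "c' j \<in> real ` {0..q}" if j: "j \<in> E" for j
    proof -
      have "0 \<le> \<lfloor>c j\<rfloor>" "\<lceil>c j\<rceil> \<le> int q" using c(1) j by (auto simp: ceiling_le_iff less_imp_le)
      then have "0 \<le> real_of_int \<lfloor>c j\<rfloor>" "real_of_int \<lceil>c j\<rceil> \<le> real q" by linarith+
      moreover have "of_int \<lfloor>c j\<rfloor> \<le> c' j" "c' j \<le> of_int \<lceil>c j\<rceil>" using c'(1) j by blast+
      moreover obtain z where z: "c' j = of_int z" using c'(1) j Ints_cases by metis
      ultimately have "0 \<le> z" "z \<le> int q" by linarith+
      then show ?thesis using z by (intro image_eqI[of _ _ "nat z"]) auto
    qed
    then have "restrict c' E \<in> ?K" by auto
    moreover have "(\<Sum>j\<in>E. restrict c' E j *\<^sub>R v j) = x" using c'(2) by (simp cong: sum.cong)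
    ultimately show "x \<in> (\<lambda>c. \<Sum>j\<in>E. c j *\<^sub>R v j) ` ?K" by blast
  qed
  show "finite ((\<lambda>c. \<Sum>j\<in>E. c j *\<^sub>R v j) ` ?K)"
    using E by (intro finite_imageI finite_PiE) auto
qed

text \<open>
Let \<open>K\<close> be the parameters at which the line through \<open>x\<close> meets the closed zonotope. Rounding the
coefficient of \<open>v m\<close> shows that \<open>K\<close> contains the floor and the ceiling of each of its members.
As \<open>K\<close> is bounded, its extreme members are integers \<open>a\<close> and \<open>b\<close>. If \<open>v m\<close> is in the span
of the others, coefficients in the open cube can be perturbed so as to move the point along
the line, hence \<open>J\<close> is open and, by convexity, all of the open interval between \<open>a\<close> and \<open>b\<close>.
Otherwise the line meets the zonotope at most once.
\<close>

lemma line_meets_open_zonotope_in_interval: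
  fixes q :: nat
  assumes uni: "unimodular_family L (insert m E) v" and E: "finite E" "m \<notin> E"
    and vm: "v m \<noteq> 0" and x: "x \<in> L"
  defines "J \<equiv> {s. x + s *\<^sub>R v m \<in> open_zonotope v (real q) E}"
  assumes J: "J \<noteq> {}"
  obtains (interval) a b :: int where "v m \<in> span (v ` E)" "a < b" "J = {of_int a<..<of_int b}"
    | (point) a :: int where "v m \<notin> span (v ` E)" "J = {of_int a}"
proof -
  define K where "K = {s. \<exists>c. (\<forall>j\<in>E. 0 \<le> c j \<and> c j \<le> real q) \<and> x + s *\<^sub>R v m = (\<Sum>j\<in>E. c j *\<^sub>R v j)}"
  have JK: "J \<subseteq> K"
    unfolding J_def K_def open_zonotope_def using less_imp_le by blast
  have round: "\<exists>z::int. of_int z \<in> K \<and> \<lfloor>s\<rfloor> \<le> z \<and> z \<le> \<lceil>s\<rceil> \<and> \<sigma> * of_int z \<le> \<sigma> * s"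
    if s: "s \<in> K" for s \<sigma> :: real
  proof -
    obtain c where c: "\<forall>j\<in>E. 0 \<le> c j \<and> c j \<le> real q" "x + s *\<^sub>R v m = (\<Sum>j\<in>E. c j *\<^sub>R v j)"
      using s unfolding K_def by blast
    have "(\<Sum>j\<in>E. (c(m := - s)) j *\<^sub>R v j) = (\<Sum>j\<in>E. c j *\<^sub>R v j)"
      using E by (intro sum.cong) auto
    then have sum: "(\<Sum>j\<in>insert m E. (c(m := - s)) j *\<^sub>R v j) = x"
      using E by (simp flip: c(2))
    then have "(\<Sum>j\<in>insert m E. (c(m := - s)) j *\<^sub>R v j) \<in> L" using x by simp
    from unimodular_rounding[OF uni _ this, of \<sigma> m] E(1)
    obtain c' where c': "\<forall>j\<in>insert m E. c' j \<in> \<int> \<and> of_int \<lfloor>(c(m := - s)) j\<rfloor> \<le> c' j \<and> c' j \<le> of_int \<lceil>(c(m := - s)) j\<rceil>"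
      "(\<Sum>j\<in>insert m E. c' j *\<^sub>R v j) = x" "\<sigma> * (- s) \<le> \<sigma> * c' m"
      using sum by auto
    obtain z where z: "c' m = of_int z" using c'(1) Ints_cases by blast
    have "of_int \<lfloor>- s\<rfloor> \<le> c' m" "c' m \<le> of_int \<lceil>- s\<rceil>" using c'(1) by auto
    then have b: "\<lfloor>s\<rfloor> \<le> - z" "- z \<le> \<lceil>s\<rceil>" using z by (auto simp: ceiling_def)
    have "0 \<le> c' j \<and> c' j \<le> real q" if j: "j \<in> E" for j
    proof -
      have "j \<noteq> m" using j E by blast
      have "0 \<le> \<lfloor>c j\<rfloor>" "\<lceil>c j\<rceil> \<le> int q" using c(1) j by (auto simp: ceiling_le_iff)
      then have "0 \<le> real_of_int \<lfloor>c j\<rfloor>" "real_of_int \<lceil>c j\<rceil> \<le> real q" by linarith+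
      moreover have "of_int \<lfloor>c j\<rfloor> \<le> c' j" "c' j \<le> of_int \<lceil>c j\<rceil>"
        using c'(1) j \<open>j \<noteq> m\<close> by (metis fun_upd_other insertCI)+
      ultimately show ?thesis by linarith
    qed
    moreover have "x + of_int (- z) *\<^sub>R v m = (\<Sum>j\<in>E. c' j *\<^sub>R v j)"
      using c'(2) z E by (simp add: algebra_simps)
    ultimately have "of_int (- z) \<in> K" unfolding K_def by blast
    moreover have "\<sigma> * of_int (- z) \<le> \<sigma> * s" using c'(3) z by simp
    ultimately show ?thesis using b by blast
  qed
  have floor: "of_int \<lfloor>s\<rfloor> \<in> K" and ceil: "of_int \<lceil>s\<rceil> \<in> K" if s: "s \<in> K" for s
  proof -
    obtain z where z: "of_int z \<in> K" "\<lfloor>s\<rfloor> \<le> z" "1 * of_int z \<le> 1 * s"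
      using round[OF s, of 1] by blast
    then have "z = \<lfloor>s\<rfloor>" by linarith
    then show "of_int \<lfloor>s\<rfloor> \<in> K" using z by simp
    obtain z where z: "of_int z \<in> K" "z \<le> \<lceil>s\<rceil>" "-1 * of_int z \<le> -1 * s"
      using round[OF s, of "-1"] by blast
    then have "z = \<lceil>s\<rceil>" by linarith
    then show "of_int \<lceil>s\<rceil> \<in> K" using z by simp
  qed
  \<comment> \<open>The inner product with \<open>v m\<close> recovers \<open>s\<close> from the point on the line.\<close>
  define B where "B = ((\<Sum>j\<in>E. real q * \<bar>v j \<bullet> v m\<bar>) + \<bar>x \<bullet> v m\<bar>) / (v m \<bullet> v m)"
  have bound: "\<bar>s\<bar> \<le> B" if s: "s \<in> K" for s
  proof -
    obtain c where c: "\<forall>j\<in>E. 0 \<le> c j \<and> c j \<le> real q" "x + s *\<^sub>R v m = (\<Sum>j\<in>E. c j *\<^sub>R v j)"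
      using s unfolding K_def by blast
    have "x \<bullet> v m + s * (v m \<bullet> v m) = (\<Sum>j\<in>E. c j * (v j \<bullet> v m))"
      using arg_cong[OF c(2), of "\<lambda>y. y \<bullet> v m"] by (simp add: inner_add_left inner_sum_left)
    moreover have "\<bar>\<Sum>j\<in>E. c j * (v j \<bullet> v m)\<bar> \<le> (\<Sum>j\<in>E. real q * \<bar>v j \<bullet> v m\<bar>)"
      using c(1) by (intro order_trans[OF sum_abs] sum_mono) (auto simp: abs_mult intro: mult_right_mono)
    ultimately have "\<bar>s * (v m \<bullet> v m)\<bar> \<le> (\<Sum>j\<in>E. real q * \<bar>v j \<bullet> v m\<bar>) + \<bar>x \<bullet> v m\<bar>"
      by linarith
    then show ?thesis
      using vm unfolding B_def by (simp add: pos_le_divide_eq abs_mult)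
  qed
  define Z where "Z = {k::int. of_int k \<in> K}"
  have "Z \<subseteq> {- \<lceil>B\<rceil>..\<lceil>B\<rceil>}"
  proof
    fix k assume "k \<in> Z"
    then have "\<bar>of_int k\<bar> \<le> B" using bound unfolding Z_def by blast
    then show "k \<in> {- \<lceil>B\<rceil>..\<lceil>B\<rceil>}" by simp linarith
  qed
  then have finZ: "finite Z" using finite_subset by blast
  obtain s0 where s0: "s0 \<in> J" using J by blast
  define a b where "a = Min Z" and "b = Max Z"
  have "Z \<noteq> {}" using s0 JK floor unfolding Z_def by blast
  then have ab: "of_int a \<in> K" "of_int b \<in> K"
    using Min_in[OF finZ] Max_in[OF finZ] unfolding a_def b_def Z_def by auto
  have Kab: "of_int a \<le> s \<and> s \<le> of_int b" if "s \<in> K" for s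
  proof -
    have "a \<le> \<lfloor>s\<rfloor>" "\<lceil>s\<rceil> \<le> b"
      unfolding a_def b_def
      using floor[OF that] ceil[OF that] finZ by (auto intro!: Min_le Max_ge simp: Z_def)
    then show ?thesis by linarith
  qed
  show ?thesis
  proof (cases "v m \<in> span (v ` E)")
    case True
    then obtain d where d: "v m = (\<Sum>j\<in>E. d j *\<^sub>R v j)" using in_span_imageD E(1) by metis
    have opn: "\<exists>\<epsilon>>0. s + \<epsilon> \<in> J \<and> s - \<epsilon> \<in> J" if s: "s \<in> J" for s
    proof -
      obtain c where c: "\<forall>j\<in>E. 0 < c j \<and> c j < real q" "x + s *\<^sub>R v m = (\<Sum>j\<in>E. c j *\<^sub>R v j)"
        using s unfolding J_def open_zonotope_def by blast
      \<comment> \<open>A perturbation of size \<open>g j\<close> along \<open>d\<close> keeps the \<open>j\<close>-th coefficient in the open interval.\<close>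
      define g where "g j = min (c j) (real q - c j) / (\<bar>d j\<bar> + 1)" for j
      define \<epsilon> where "\<epsilon> = Min (insert 1 (g ` E))"
      have gpos: "g j > 0" if "j \<in> E" for j
        using c(1) that unfolding g_def by (intro divide_pos_pos) auto
      have \<epsilon>: "\<epsilon> > 0" using E(1) gpos unfolding \<epsilon>_def by (subst Min_gr_iff) auto
      have small: "\<epsilon> * \<bar>d j\<bar> < min (c j) (real q - c j)" if "j \<in> E" for j
      proof -
        have "\<epsilon> \<le> g j" using E(1) that unfolding \<epsilon>_def by (intro Min_le) auto
        then have "\<epsilon> * (\<bar>d j\<bar> + 1) \<le> min (c j) (real q - c j)"
          unfolding g_def by (subst (asm) pos_le_divide_eq) auto
        then show ?thesis using \<epsilon> by (simp only: distrib_left)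
      qed
      have "s + \<tau> \<in> J" if \<tau>: "\<tau> = \<epsilon> \<or> \<tau> = - \<epsilon>" for \<tau>
      proof -
        have "x + (s + \<tau>) *\<^sub>R v m = (\<Sum>j\<in>E. (c j + \<tau> * d j) *\<^sub>R v j)"
        proof -
          have "x + (s + \<tau>) *\<^sub>R v m = (x + s *\<^sub>R v m) + \<tau> *\<^sub>R v m"
            by (simp add: scaleR_left_distrib)
          also have "\<dots> = (\<Sum>j\<in>E. c j *\<^sub>R v j) + \<tau> *\<^sub>R (\<Sum>j\<in>E. d j *\<^sub>R v j)"
            using c(2) d by argo
          finally show ?thesis
            by (simp add: scaleR_left_distrib sum.distrib scaleR_right.sum)
        qed
        moreover have "0 < c j + \<tau> * d j \<and> c j + \<tau> * d j < real q" if "j \<in> E" for j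
        proof -
          have "\<bar>\<tau> * d j\<bar> = \<epsilon> * \<bar>d j\<bar>" using \<tau> \<epsilon> by (auto simp: abs_mult)
          then show ?thesis using small[OF that] by linarith
        qed
        ultimately show ?thesis unfolding J_def open_zonotope_def mem_Collect_eq
          by (intro exI[of _ "\<lambda>j. c j + \<tau> * d j"]) auto
      qed
      from this[of \<epsilon>] this[of "- \<epsilon>"] show ?thesis using \<epsilon> by auto
    qed
    have Jab: "of_int a < s \<and> s < of_int b" if s: "s \<in> J" for s
    proof -
      obtain \<epsilon> where "\<epsilon> > 0" "s + \<epsilon> \<in> J" "s - \<epsilon> \<in> J" using opn[OF s] by blast
      then show ?thesis using Kab[of "s + \<epsilon>"] Kab[of "s - \<epsilon>"] JK by (auto simp: subset_iff)
    qed
    \<comment> \<open>A proper convex combination of coefficients in the open and in the closed cube is in the open cube.\<close>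
    have mix: "l * s0 + (1 - l) * t \<in> J" if t: "t \<in> K" and l: "0 < l" "l \<le> 1" for t l
    proof -
      obtain c where c: "\<forall>j\<in>E. 0 < c j \<and> c j < real q" "x + s0 *\<^sub>R v m = (\<Sum>j\<in>E. c j *\<^sub>R v j)"
        using s0 unfolding J_def open_zonotope_def by blast
      obtain e where e: "\<forall>j\<in>E. 0 \<le> e j \<and> e j \<le> real q" "x + t *\<^sub>R v m = (\<Sum>j\<in>E. e j *\<^sub>R v j)"
        using t unfolding K_def by blast
      have "x + (l * s0 + (1 - l) * t) *\<^sub>R v m = l *\<^sub>R (x + s0 *\<^sub>R v m) + (1 - l) *\<^sub>R (x + t *\<^sub>R v m)"
        by (simp add: algebra_simps)
      also have "\<dots> = (\<Sum>j\<in>E. (l * c j + (1 - l) * e j) *\<^sub>R v j)"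
        unfolding c(2) e(2) by (simp add: scaleR_left_distrib sum.distrib scaleR_right.sum)
      finally have "x + (l * s0 + (1 - l) * t) *\<^sub>R v m = (\<Sum>j\<in>E. (l * c j + (1 - l) * e j) *\<^sub>R v j)" .
      moreover have "0 < l * c j + (1 - l) * e j \<and> l * c j + (1 - l) * e j < real q" if "j \<in> E" for j
      proof -
        have "0 < l * c j" "l * c j < l * real q" using c(1) l that by auto
        moreover have "0 \<le> (1 - l) * e j" "(1 - l) * e j \<le> (1 - l) * real q"
          using e(1) l that by (auto intro: mult_left_mono)
        ultimately show ?thesis by (auto simp: algebra_simps)
      qed
      ultimately show ?thesis unfolding J_def open_zonotope_def mem_Collect_eq
        by (intro exI[of _ "\<lambda>j. l * c j + (1 - l) * e j"]) auto
    qed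
    have mid: "r \<in> J" if r: "min t s0 < r" "r < max t s0" and t: "t \<in> K" "t \<noteq> s0" for r t
    proof -
      define l where "l = (r - t) / (s0 - t)"
      have "l * s0 + (1 - l) * t = t + l * (s0 - t)" by (simp add: algebra_simps)
      also have "\<dots> = r" using t by (simp add: l_def)
      finally have "l * s0 + (1 - l) * t = r" .
      moreover have "0 < l" "l \<le> 1" using r t(2) unfolding l_def
        by (cases "t < s0"; simp add: zero_less_divide_iff divide_le_eq_1)+
      ultimately show ?thesis using mix[OF t(1)] by metis
    qed
    have "J = {of_int a<..<of_int b}"
    proof (intro equalityI subsetI)
      fix r :: real assume r: "r \<in> {of_int a<..<of_int b}"
      have "of_int a < s0" "s0 < of_int b" using Jab s0 by auto
      then show "r \<in> J"
        using r s0 mid[OF _ _ ab(1), of r] mid[OF _ _ ab(2), of r]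
        by (cases r s0 rule: linorder_cases) auto
    qed (use Jab in auto)
    moreover have "a < b" using Jab[OF s0] by linarith
    ultimately show ?thesis using interval True by blast
  next
    case False
    have uniq: "s = t" if st: "s \<in> K" "t \<in> K" for s t
    proof (rule ccontr)
      assume "s \<noteq> t"
      obtain c where c: "x + s *\<^sub>R v m = (\<Sum>j\<in>E. c j *\<^sub>R v j)"
        using st(1) unfolding K_def by blast
      obtain e where e: "x + t *\<^sub>R v m = (\<Sum>j\<in>E. e j *\<^sub>R v j)"
        using st(2) unfolding K_def by blast
      have "(s - t) *\<^sub>R v m = (x + s *\<^sub>R v m) - (x + t *\<^sub>R v m)" by (simp add: algebra_simps)
      also have "\<dots> \<in> span (v ` E)"
        unfolding c e by (intro span_diff span_sum span_scale span_base imageI)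
      finally have "(1 / (s - t)) *\<^sub>R ((s - t) *\<^sub>R v m) \<in> span (v ` E)" by (rule span_scale)
      then show False using False \<open>s \<noteq> t\<close> by simp
    qed
    have "J = {of_int a}"
      using s0 JK uniq[OF _ ab(1)] by blast
    then show ?thesis using point False by blast
  qed
qed

section \<open>Counting along lines\<close>

text \<open>
Adding \<open>v m\<close> with coefficients in \<open>(0, q)\<close> replaces the interval \<open>(a, b)\<close> by \<open>(a, b + q)\<close>,
which has \<open>q\<close> more integers. A single point \<open>a\<close> becomes \<open>(a, a + q)\<close>.
\<close>

lemma card_lattice_points_on_line:
  fixes q :: nat
  assumes uni: "unimodular_family L (insert m E) v" and E: "finite E" "m \<notin> E"
    and vm: "v m \<noteq> 0" and x: "x \<in> L" and q: "q > 0"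
    and ne: "project_along (v m) x \<in> open_zonotope (\<lambda>j. project_along (v m) (v j)) (real q) E"
  shows "int (card {k::int. x + of_int k *\<^sub>R v m \<in> open_zonotope v (real q) (insert m E)}) =
    (if v m \<in> span (v ` E)
     then int (card {k::int. x + of_int k *\<^sub>R v m \<in> open_zonotope v (real q) E}) + int q
     else int q - 1)"
proof -
  define J where "J = {s. x + s *\<^sub>R v m \<in> open_zonotope v (real q) E}"
  have J0: "{k::int. x + of_int k *\<^sub>R v m \<in> open_zonotope v (real q) E} = {k. of_int k \<in> J}"
    by (simp add: J_def)
  have J1: "{k::int. x + of_int k *\<^sub>R v m \<in> open_zonotope v (real q) (insert m E)} =
      {k. \<exists>t. 0 < t \<and> t < real q \<and> of_int k - t \<in> J}"
    unfolding open_zonotope_insert[OF E] J_def by (simp add: algebra_simps)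
  have "J \<noteq> {}"
    using ne unfolding project_in_open_zonotope_iff J_def by blast
  then consider a b :: int where "v m \<in> span (v ` E)" "a < b" "J = {of_int a<..<of_int b}"
    | a :: int where "v m \<notin> span (v ` E)" "J = {of_int a}"
    using line_meets_open_zonotope_in_interval[OF uni E vm x, of q] unfolding J_def by metis
  then show ?thesis
  proof cases
    case 1
    have "{k::int. \<exists>t. 0 < t \<and> t < real q \<and> of_int k - t \<in> J} = {a<..<b + int q}"
    proof (intro equalityI subsetI)
      fix k assume "k \<in> {k::int. \<exists>t. 0 < t \<and> t < real q \<and> of_int k - t \<in> J}"
      then obtain t where "0 < t" "t < real q" "of_int a < of_int k - t" "of_int k - t < of_int b"
        unfolding 1 by auto
      then have "of_int a < (of_int k :: real)" "of_int k < (of_int (b + int q) :: real)" by auto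
      then show "k \<in> {a<..<b + int q}" by simp
    next
      fix k assume "k \<in> {a<..<b + int q}"
      then have "of_int a < (of_int k :: real)" "of_int k < (of_int (b + int q) :: real)"
        unfolding of_int_less_iff by auto
      moreover have "of_int a < (of_int b :: real)" using 1 by simp
      ultimately have "max 0 (of_int k - of_int b) < min (real q) (of_int k - of_int a)"
        using q by auto
      then obtain t where "max 0 (of_int k - of_int b) < t" "t < min (real q) (of_int k - of_int a)"
        using dense by blast
      then show "k \<in> {k::int. \<exists>t. 0 < t \<and> t < real q \<and> of_int k - t \<in> J}"
        unfolding 1 by (intro CollectI exI[of _ t]) auto
    qed
    moreover have "{k::int. of_int k \<in> J} = {a<..<b}" unfolding 1 by auto
    ultimately show ?thesis using 1 unfolding J0 J1 by simp
  next
    case 2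
    have "{k::int. \<exists>t. 0 < t \<and> t < real q \<and> of_int k - t \<in> J} = {a<..<a + int q}"
    proof (intro equalityI subsetI)
      fix k assume "k \<in> {k::int. \<exists>t. 0 < t \<and> t < real q \<and> of_int k - t \<in> J}"
      then obtain t where "0 < t" "t < real q" "of_int k - t = of_int a"
        unfolding 2 by auto
      then have "of_int a < (of_int k :: real)" "of_int k < (of_int (a + int q) :: real)" by auto
      then show "k \<in> {a<..<a + int q}" by simp
    next
      fix k assume "k \<in> {a<..<a + int q}"
      then have "of_int a < (of_int k :: real)" "of_int k < (of_int (a + int q) :: real)"
        unfolding of_int_less_iff by auto
      then show "k \<in> {k::int. \<exists>t. 0 < t \<and> t < real q \<and> of_int k - t \<in> J}"
        unfolding 2 by (intro CollectI exI[of _ "of_int k - of_int a"]) auto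
    qed
    then show ?thesis using 2 q unfolding J0 J1 by simp
  qed
qed

text \<open>
Unimodularity of the one-element family \<open>v m\<close> says that \<open>v m\<close> is primitive: lattice points with
the same projection differ by an integer multiple of it.
\<close>

lemma card_projection_fibre:
  assumes uni: "unimodular_family L E v" and m: "m \<in> E" "v m \<noteq> 0" and x: "x \<in> L"
  shows "card {y \<in> L \<inter> Z. project_along (v m) y = project_along (v m) x} =
    card {k::int. x + of_int k *\<^sub>R v m \<in> Z}"
proof -
  note lin = linear_project_along[of "v m"]
  let ?f = "\<lambda>k::int. x + of_int k *\<^sub>R v m"
  have "{y \<in> L \<inter> Z. project_along (v m) y = project_along (v m) x} = ?f ` {k. ?f k \<in> Z}"
  proof (intro equalityI subsetI)
    fix y assume y: "y \<in> {y \<in> L \<inter> Z. project_along (v m) y = project_along (v m) x}"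
    then have "project_along (v m) (y - x) = 0" by (simp add: linear_diff[OF lin])
    then obtain t where t: "y - x = t *\<^sub>R v m" using project_along_eq_0D by blast
    have "lin_indep v {m}" using m(2) by (simp add: lin_indep_def)
    moreover have "y - x \<in> L" using y x diff_in_lattice[OF uni] by blast
    ultimately have "t \<in> \<int>"
      using unimodular_familyD[OF uni, of "{m}" "\<lambda>_. t" m] m t by simp
    then obtain k where "t = of_int k" by (rule Ints_cases)
    then have "y = ?f k" using t by (simp add: algebra_simps)
    then show "y \<in> ?f ` {k. ?f k \<in> Z}" using y by blast
  next
    fix y assume "y \<in> ?f ` {k. ?f k \<in> Z}"
    then obtain k where "y = ?f k" "?f k \<in> Z" by blast
    moreover have "?f k \<in> L"
      using x m by (intro add_in_lattice[OF uni] Ints_multiple_in_lattice[OF uni] vector_in_lattice[OF uni]) auto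
    moreover have "project_along (v m) (?f k) = project_along (v m) x"
      by (simp add: linear_add[OF lin] linear_scale[OF lin])
    ultimately show "y \<in> {y \<in> L \<inter> Z. project_along (v m) y = project_along (v m) x}" by blast
  qed
  moreover have "inj_on ?f {k. ?f k \<in> Z}" using m by (intro inj_onI) simp
  ultimately show ?thesis by (simp add: card_image)
qed

text \<open>
The deletion-contraction recursion, obtained by adding up the previous count over the lattice
lines in direction \<open>v m\<close> that meet the zonotope of \<open>E\<close>. If \<open>v m\<close> is not in the span (a coloop),
each of them has \<open>q - 1\<close> points and the deletion does not enter.
\<close>

lemma card_open_zonotope_insert:
  fixes q :: nat
  assumes uni: "unimodular_family L (insert m E) v" and E: "finite E" "m \<notin> E"
    and vm: "v m \<noteq> 0" and q: "q > 0"
  defines "N' \<equiv> card (project_along (v m) ` L \<inter> open_zonotope (\<lambda>j. project_along (v m) (v j)) (real q) E)"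
  shows "int (card (L \<inter> open_zonotope v (real q) (insert m E))) =
    (if v m \<in> span (v ` E) then int (card (L \<inter> open_zonotope v (real q) E)) + int q * int N'
     else (int q - 1) * int N')"
proof -
  let ?p = "project_along (v m)"
  define Y where "Y = ?p ` L \<inter> open_zonotope (\<lambda>j. ?p (v j)) (real q) E"
  have uniE: "unimodular_family L E v" using uni by (rule unimodular_family_subset) auto
  have finY: "finite Y"
    unfolding Y_def using unimodular_family_contract[OF uni E vm] E(1) by (rule finite_lattice_points_open_zonotope)
  have fin1: "finite (L \<inter> open_zonotope v (real q) (insert m E))"
    using uni E(1) by (intro finite_lattice_points_open_zonotope) auto
  have fin0: "finite (L \<inter> open_zonotope v (real q) E)"
    using uniE E(1) by (rule finite_lattice_points_open_zonotope)
  have im0: "?p ` (L \<inter> open_zonotope v (real q) E) \<subseteq> Y"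
  proof (rule image_subsetI)
    fix y assume y: "y \<in> L \<inter> open_zonotope v (real q) E"
    then have "y + 0 *\<^sub>R v m \<in> open_zonotope v (real q) E" by simp
    then show "?p y \<in> Y" using y unfolding Y_def by (auto simp only: project_in_open_zonotope_iff)
  qed
  have im1: "?p ` (L \<inter> open_zonotope v (real q) (insert m E)) \<subseteq> Y"
  proof (rule image_subsetI)
    fix y assume y: "y \<in> L \<inter> open_zonotope v (real q) (insert m E)"
    then obtain t where "y + (- t) *\<^sub>R v m \<in> open_zonotope v (real q) E"
      unfolding open_zonotope_insert[OF E] Int_iff by auto
    then show "?p y \<in> Y" using y unfolding Y_def by (auto simp only: project_in_open_zonotope_iff)
  qed
  have fibre: "int (card {y \<in> L \<inter> open_zonotope v (real q) (insert m E). ?p y = z}) =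
      (if v m \<in> span (v ` E) then int (card {y \<in> L \<inter> open_zonotope v (real q) E. ?p y = z}) + int q
       else int q - 1)" if z: "z \<in> Y" for z
  proof -
    obtain x where x: "x \<in> L" "z = ?p x" "?p x \<in> open_zonotope (\<lambda>j. ?p (v j)) (real q) E"
      using z unfolding Y_def by blast
    show ?thesis
      unfolding x(2) card_projection_fibre[OF uni insertI1 vm x(1)]
      by (rule card_lattice_points_on_line[OF uni E vm x(1) q x(3)])
  qed
  have count: "int (card S) = (\<Sum>z\<in>Y. int (card {y \<in> S. ?p y = z}))" if "finite S" "?p ` S \<subseteq> Y" for S
    using sum_fun_comp[OF that(1) finY that(2), of "\<lambda>_. 1 :: int"] by simp
  have N': "N' = card Y" unfolding N'_def Y_def ..
  have "int (card (L \<inter> open_zonotope v (real q) (insert m E))) =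
      (\<Sum>z\<in>Y. if v m \<in> span (v ` E) then int (card {y \<in> L \<inter> open_zonotope v (real q) E. ?p y = z}) + int q
         else int q - 1)"
    unfolding count[OF fin1 im1] by (intro sum.cong refl fibre)
  then show ?thesis
    unfolding count[OF fin0 im0] N' by (simp add: sum.distrib mult.commute)
qed

lemma card_open_zonotope_insert_zero:
  assumes "finite E" "m \<notin> E" "v m = 0" "q > 0"
  shows "open_zonotope v q (insert m E) = open_zonotope v q E"
  using assms(4) dense[of 0 q] by (auto simp: set_eq_iff open_zonotope_insert[OF assms(1,2)] assms(3))

section \<open>The signed sum over independent subfamilies\<close>

text \<open>
Split the independent subsets of \<open>insert m E\<close> into those with and those without \<open>m\<close>. The former
are the independent sets of the contraction; both the dimension and the cardinality drop by one,
so their part is \<open>q\<close> times the sum for the contraction. The latter are the independent sets of the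
deletion, with the same dimension, unless \<open>m\<close> is a coloop. For a coloop they are again the
independent sets of the contraction, but only the dimension drops, and the opposite sign turns
\<open>q\<close> into \<open>q - 1\<close>. Adding a zero vector affects neither side.
\<close>

theorem card_lattice_points_open_zonotope:
  fixes v :: "'b \<Rightarrow> 'a::euclidean_space" and q :: nat
  assumes "finite E" "unimodular_family L E v" and q: "q > 0"
  shows "int (card (L \<inter> open_zonotope v (real q) E)) =
    (\<Sum>I\<in>Pow E. if lin_indep v I then (-1) ^ (dim (v ` E) + card I) * int q ^ card I else 0)"
  using assms(1,2)
proof (induction E arbitrary: L v rule: finite_induct)
  case empty
  have "L \<inter> open_zonotope v (real q) {} = {0}"
    using zero_in_lattice[OF empty] by (auto simp: open_zonotope_def)
  then show ?case by (simp add: lin_indep_def)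
next
  case (insert m E)
  note E = insert.hyps and uni = insert.prems
  have uniE: "unimodular_family L E v" using uni by (rule unimodular_family_subset) auto
  define f where "f v E I = (if lin_indep v I then (-1) ^ (dim (v ` E) + card I) * int q ^ card I else 0)"
    for v :: "'b \<Rightarrow> 'a" and E I
  have IH: "int (card (L \<inter> open_zonotope v (real q) E)) = (\<Sum>I\<in>Pow E. f v E I)"
    if "unimodular_family L E v" for L and v :: "'b \<Rightarrow> 'a"
    using insert.IH[OF that] unfolding f_def .
  have split: "(\<Sum>I\<in>Pow (insert m E). g I) = (\<Sum>I\<in>Pow E. g I) + (\<Sum>I\<in>Pow E. g (insert m I))"
    for g :: "'b set \<Rightarrow> int"
  proof -
    have "inj_on (insert m) (Pow E)" using E(2) by (intro inj_onI) (metis PowD subsetD insert_ident)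
    then show ?thesis
      using E unfolding Pow_insert
      by (subst sum.union_disjoint) (auto simp: sum.reindex)
  qed
  have fin: "finite I" "m \<notin> I" if "I \<in> Pow E" for I using that E finite_subset by auto
  have dim_same: "dim (v ` insert m E) = dim (v ` E)" if "v m \<in> span (v ` E)"
  proof -
    have "span (v ` insert m E) = span (v ` E)" using that by (simp add: span_redundant)
    then show ?thesis by (metis dim_span)
  qed
  have "int (card (L \<inter> open_zonotope v (real q) (insert m E))) = (\<Sum>I\<in>Pow (insert m E). f v (insert m E) I)"
  proof (cases "v m = 0")
    case True
    have "f v (insert m E) (insert m I) = 0" if "I \<in> Pow E" for I
      using not_lin_indep_zero[of "insert m I" v m] fin[OF that] True by (simp add: f_def)
    moreover have "f v (insert m E) I = f v E I" for I
      using dim_same True by (simp add: f_def span_zero)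
    ultimately show ?thesis
      using card_open_zonotope_insert_zero[of E m v "real q"] E True q IH[OF uniE] by (simp add: split)
  next
    case vm: False
    define w where "w j = project_along (v m) (v j)" for j
    have IHw: "int (card (project_along (v m) ` L \<inter> open_zonotope w (real q) E)) = (\<Sum>I\<in>Pow E. f w E I)"
      using unimodular_family_contract[OF uni E vm] unfolding w_def[symmetric] by (rule IH)
    have indep: "lin_indep v (insert m I) \<longleftrightarrow> lin_indep w I" if "I \<in> Pow E" for I
      using lin_indep_insert_iff_project[of I m v] fin[OF that] vm unfolding w_def by blast
    have dim: "dim (v ` insert m E) = Suc (dim (w ` E))"
      using dim_insert_project[of v m E] vm unfolding w_def by blast
    have "f v (insert m E) (insert m I) = int q * f w E I" if "I \<in> Pow E" for I
      using indep[OF that] fin[OF that] unfolding f_def dim by simp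
    then have sum1: "(\<Sum>I\<in>Pow E. f v (insert m E) (insert m I)) = int q * (\<Sum>I\<in>Pow E. f w E I)"
      by (simp add: sum_distrib_left)
    show ?thesis
    proof (cases "v m \<in> span (v ` E)")
      case True
      then have "f v (insert m E) I = f v E I" for I
        using dim_same by (simp add: f_def)
      then show ?thesis
        using card_open_zonotope_insert[OF uni E vm q] True IH[OF uniE] IHw sum1
        unfolding split w_def[symmetric] by simp
    next
      case False
      have "f v (insert m E) I = - f w E I" if I: "I \<in> Pow E" for I
      proof -
        have "v m \<notin> span (v ` I)" using False I span_mono[of "v ` I" "v ` E"] by blast
        then have "lin_indep v I \<longleftrightarrow> lin_indep w I"
          using lin_indep_insert_notin_span[of I v m] fin[OF I] indep[OF I] by blast
        then show ?thesis unfolding f_def dim by simp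
      qed
      then have "(\<Sum>I\<in>Pow E. f v (insert m E) I) = - (\<Sum>I\<in>Pow E. f w E I)"
        by (simp add: sum_negf)
      then show ?thesis
        using card_open_zonotope_insert[OF uni E vm q] False IHw sum1
        unfolding split w_def[symmetric] by (simp add: algebra_simps)
    qed
  qed
  then show ?case unfolding f_def .
qed

section \<open>Totally unimodular matrices\<close>

lemma Ints_det:
  fixes M :: "real mat"
  assumes M: "M \<in> carrier_mat k k" and "\<And>i j. i < k \<Longrightarrow> j < k \<Longrightarrow> M $$ (i, j) \<in> \<int>"
  shows "Determinant.det M \<in> \<int>"
proof -
  have "(\<Prod>i = 0..<k. M $$ (i, p i)) \<in> \<int>" if "p permutes {0..<k}" for p
    using assms(2) permutes_in_image[OF that] by (intro Ints_prod) auto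
  moreover have "signof p \<in> (\<int> :: real set)" for p by (simp add: sign_def)
  ultimately show ?thesis
    unfolding det_def'[OF M] by (intro Ints_sum Ints_mult) auto
qed

lemma totally_unimodular_entry:
  assumes "totally_unimodular A"
  shows "A $ i $ j \<in> \<int>"
proof -
  have "Determinant.det (Matrix.mat 1 1 (\<lambda>(a, b). A $ i $ j)) \<in> {-1, 0, 1}"
    using assms[unfolded totally_unimodular_def, rule_format, of "\<lambda>_. i" "1" "\<lambda>_. j"]
    by (simp add: inj_on_def)
  moreover have "Determinant.det (Matrix.mat 1 1 (\<lambda>(a, b). A $ i $ j)) = A $ i $ j"
    by (subst det_single) auto
  ultimately show ?thesis by auto
qed

text \<open>
Erase the columns outside \<open>G\<close>. The remaining matrix has rank \<open>card G\<close>, hence equally many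
independent rows, and the minor with these rows is nonzero since a relation between its rows
would be one between theirs.
\<close>

lemma independent_columns_nonzero_minor:
  fixes A :: "real^'m^'r"
  assumes indep: "lin_indep (\<lambda>j. column j A) G"
  obtains f g where "inj_on f {..<card G}" "bij_betw g {..<card G} G"
    "Determinant.det (Matrix.mat (card G) (card G) (\<lambda>(i, j). A $ f i $ g j)) \<noteq> 0"
proof -
  define k where "k = card G"
  define B :: "real^'m^'r" where "B = (\<chi> i j. if j \<in> G then A $ i $ j else 0)"
  have "k = card ((\<lambda>j. column j A) ` G)"
    using indep unfolding k_def by (simp add: lin_indep_iff_independent_image card_image)
  also have "\<dots> \<le> dim (columns B)"
  proof (rule independent_card_le_dim)
    have "column j A = column j B" if "j \<in> G" for j
      using that by (simp add: B_def column_def)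
    then show "(\<lambda>j. column j A) ` G \<subseteq> columns B" by (auto simp: columns_def)
    show "independent ((\<lambda>j. column j A) ` G)"
      using indep by (simp add: lin_indep_iff_independent_image)
  qed
  also have "\<dots> = dim (rows B)" using row_rank_def[of B] column_rank_def[of B] by simp
  finally have k: "k \<le> dim (rows B)" .
  obtain R where R: "R \<subseteq> rows B" "independent R" "card R = dim (rows B)"
    by (rule basis_exists[of "rows B"])
  obtain R' where R': "R' \<subseteq> R" "card R' = k" "finite R'"
    using obtain_subset_with_card_n[of k R] k R(3) by auto
  obtain h where h: "bij_betw h {..<k} R'"
    using ex_bij_betw_nat_finite[OF R'(3)] unfolding R'(2) atLeast0LessThan by blast
  have "\<exists>r. row r B = h i" if "i < k" for i
  proof -
    have "h i \<in> rows B" using bij_betwE[OF h] that R'(1) R(1) by auto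
    then show ?thesis by (auto simp: Finite_Cartesian_Product.rows_def)
  qed
  then have "\<forall>i. \<exists>r. i < k \<longrightarrow> row r B = h i" by blast
  then obtain f where "\<forall>i. i < k \<longrightarrow> row (f i) B = h i" unfolding choice_iff by blast
  then have f: "row (f i) B = h i" if "i < k" for i using that by blast
  have inj: "inj_on f {..<k}"
  proof (rule inj_onI)
    fix a b assume ab: "a \<in> {..<k}" "b \<in> {..<k}" "f a = f b"
    then have "h a = h b" using f[of a] f[of b] by simp
    then show "a = b" using ab(1,2) bij_betw_imp_inj_on[OF h] by (rule inj_onD[rotated])
  qed
  have indep_h: "lin_indep h {..<k}"
    using h independent_mono[OF R(2) R'(1)]
    by (auto simp: lin_indep_iff_independent_image bij_betw_def)
  obtain g where g: "bij_betw g {..<k} G"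
    using ex_bij_betw_nat_finite[of G] unfolding k_def atLeast0LessThan by auto
  define M where "M = Matrix.mat k k (\<lambda>(i, j). A $ f i $ g j)"
  have M: "M \<in> carrier_mat k k" by (simp add: M_def)
  have "Determinant.det M \<noteq> 0"
  proof
    assume "Determinant.det M = 0"
    then have "Determinant.det (transpose_mat M) = 0" using Determinant.det_transpose[OF M] by simp
    then obtain w where w: "w \<in> carrier_vec k" "w \<noteq> 0\<^sub>v k" "transpose_mat M *\<^sub>v w = 0\<^sub>v k"
      using det_0_iff_vec_prod_zero_field[of "transpose_mat M" k] M by auto
    have z: "(\<Sum>i<k. vec_index w i * A $ f i $ g j) = 0" if "j < k" for j
    proof -
      have "vec_index (transpose_mat M *\<^sub>v w) j = (\<Sum>i<k. vec_index w i * A $ f i $ g j)"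
        using that w(1) unfolding M_def
        by (simp add: mult_mat_vec_def scalar_prod_def mult.commute atLeast0LessThan)
      then show ?thesis using w(3) that by simp
    qed
    have "(\<Sum>i<k. vec_index w i *\<^sub>R h i) = 0"
    proof -
      have "(\<Sum>i<k. vec_index w i * row (f i) B $ j) = 0" for j
      proof (cases "j \<in> G")
        case True
        then obtain j' where "j' < k" "j = g j'" using g unfolding bij_betw_def by auto
        then show ?thesis using z True by (simp add: Finite_Cartesian_Product.row_def B_def)
      qed (simp add: Finite_Cartesian_Product.row_def B_def)
      then have "(\<Sum>i<k. vec_index w i *\<^sub>R row (f i) B) = 0"
        by (simp add: Finite_Cartesian_Product.vec_eq_iff)
      then show ?thesis using f by simp
    qed
    then have "\<forall>i<k. vec_index w i = 0" using indep_h unfolding lin_indep_def by blast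
    then show False using w(1,2) by (metis carrier_vecD eq_vecI index_zero_vec)
  qed
  then show ?thesis using that inj g unfolding k_def M_def by blast
qed

text \<open>
Cramer's rule: a nonzero minor on the independent columns is \<open>1\<close> or \<open>-1\<close>, so the coefficients
are determinants of integer matrices up to sign.
\<close>

theorem totally_unimodular_imp_unimodular_family:
  fixes A :: "real^'m^'r"
  assumes tu: "totally_unimodular A"
  shows "unimodular_family lattice_points UNIV (\<lambda>j. column j A)"
proof -
  note entry = totally_unimodular_entry[OF tu]
  have "c j0 \<in> \<int>"
    if indep: "lin_indep (\<lambda>j. column j A) G"
      and x: "(\<Sum>j\<in>G. c j *\<^sub>R column j A) \<in> lattice_points" and j0: "j0 \<in> G" for G c j0
  proof -
    define k where "k = card G"
    obtain f g where f: "inj_on f {..<k}" and g: "bij_betw g {..<k} G"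
      and nz: "Determinant.det (Matrix.mat k k (\<lambda>(i, j). A $ f i $ g j)) \<noteq> 0"
      using independent_columns_nonzero_minor[OF indep] unfolding k_def by blast
    define M where "M = Matrix.mat k k (\<lambda>(i, j). A $ f i $ g j)"
    have M: "M \<in> carrier_mat k k" by (simp add: M_def)
    have "Determinant.det M \<in> {-1, 0, 1}"
      unfolding M_def using tu f g unfolding totally_unimodular_def bij_betw_def by blast
    then have det: "Determinant.det M = 1 \<or> Determinant.det M = -1" using nz unfolding M_def by blast
    define y where "y = Matrix.vec k (\<lambda>j. c (g j))"
    have y: "y \<in> carrier_vec k" by (simp add: y_def)
    obtain j where j: "j < k" "j0 = g j" using g j0 unfolding bij_betw_def by auto
    have b: "vec_index (M *\<^sub>v y) i \<in> \<int>" if "i < k" for i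
    proof -
      have "vec_index (M *\<^sub>v y) i = (\<Sum>j<k. A $ f i $ g j * c (g j))"
        using that by (simp add: M_def y_def mult_mat_vec_def scalar_prod_def atLeast0LessThan)
      also have "\<dots> = (\<Sum>j\<in>G. A $ f i $ j * c j)"
        using sum.reindex_bij_betw[OF g, of "\<lambda>j. A $ f i $ j * c j"] .
      also have "\<dots> = (\<Sum>j\<in>G. c j *\<^sub>R column j A) $ f i"
        by (simp add: column_def mult.commute)
      also have "\<dots> \<in> \<int>" using x unfolding lattice_points_def by blast
      finally show ?thesis .
    qed
    have "Determinant.det (replace_col M (M *\<^sub>v y) j) \<in> \<int>"
    proof (rule Ints_det)
      show "replace_col M (M *\<^sub>v y) j \<in> carrier_mat k k" using M by (simp add: replace_col_def)
      show "replace_col M (M *\<^sub>v y) j $$ (a, e) \<in> \<int>" if "a < k" "e < k" for a e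
        using that b entry unfolding replace_col_def M_def by auto
    qed
    then have "vec_index y j * Determinant.det M \<in> \<int>"
      using cramer_lemma_mat[OF M y j(1)] by simp
    then have "vec_index y j \<in> \<int>" using det by auto
    then show ?thesis using j by (simp add: y_def)
  qed
  moreover have "column j A \<in> lattice_points" for j
    using entry by (simp add: lattice_points_def column_def)
  ultimately show ?thesis
    unfolding unimodular_family_def by (auto simp: lattice_points_def)
qed

section \<open>The zonotope of a matrix of full row rank\<close>

text \<open>
Linear maps commute with relative interiors of convex sets. The dilated zonotope is the image
of a cube, and full row rank makes its relative interior its interior.
\<close>

lemma interior_dilate_zonotope:
  fixes A :: "real^'m^'r"
  assumes rank: "rank A = CARD('r)" and q: "q > 0"
  shows "interior (dilate q (zonotope A)) = open_zonotope (\<lambda>j. column j A) (real q) UNIV"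
proof -
  let ?f = "(*v) A" and ?b = "(\<chi> j. real q) :: real^'m"
  have f: "?f x = (\<Sum>j\<in>UNIV. x $ j *\<^sub>R column j A)" for x
    by (simp add: matrix_mult_sum scalar_mult_eq_scaleR)
  have lin: "linear ?f" by (rule matrix_vector_mul_linear)
  have closed: "dilate q (zonotope A) = ?f ` cbox 0 ?b"
  proof (intro equalityI subsetI)
    fix y assume "y \<in> dilate q (zonotope A)"
    then obtain c where c: "\<forall>j. 0 \<le> c j \<and> c j \<le> 1" "y = real q *\<^sub>R (\<Sum>j\<in>UNIV. c j *\<^sub>R column j A)"
      unfolding dilate_def zonotope_def by blast
    have "y = ?f (\<chi> j. real q * c j)" by (simp add: f c(2) scaleR_right.sum)
    moreover have "(\<chi> j. real q * c j) \<in> cbox 0 ?b"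
      using c(1) by (simp add: mem_box_cart mult_left_le)
    ultimately show "y \<in> ?f ` cbox 0 ?b" by blast
  next
    fix y assume "y \<in> ?f ` cbox 0 ?b"
    then obtain x where x: "y = ?f x" "\<forall>j. 0 \<le> x $ j \<and> x $ j \<le> real q" by (auto simp: mem_box_cart)
    have "y = real q *\<^sub>R (\<Sum>j\<in>UNIV. (x $ j / real q) *\<^sub>R column j A)"
      using q by (simp add: x(1) f scaleR_right.sum)
    moreover have "\<forall>j. 0 \<le> x $ j / real q \<and> x $ j / real q \<le> 1"
      using x(2) q by simp
    ultimately show "y \<in> dilate q (zonotope A)"
      unfolding dilate_def zonotope_def mem_Collect_eq image_iff Bex_def
      by (intro exI[of _ "\<Sum>j\<in>UNIV. (x $ j / real q) *\<^sub>R column j A"] conjI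
            exI[of _ "\<lambda>j. x $ j / real q"]) auto
  qed
  have opened: "open_zonotope (\<lambda>j. column j A) (real q) UNIV = ?f ` box 0 ?b"
  proof (intro equalityI subsetI)
    fix y assume "y \<in> open_zonotope (\<lambda>j. column j A) (real q) UNIV"
    then obtain c where c: "\<forall>j. 0 < c j \<and> c j < real q" "y = (\<Sum>j\<in>UNIV. c j *\<^sub>R column j A)"
      unfolding open_zonotope_def by auto
    have "y = ?f (\<chi> j. c j)" unfolding f c(2) by simp
    moreover have "(\<chi> j. c j) \<in> box 0 ?b" using c(1) by (simp add: mem_box_cart)
    ultimately show "y \<in> ?f ` box 0 ?b" by (rule image_eqI)
  next
    fix y assume "y \<in> ?f ` box 0 ?b"
    then obtain x where x: "y = ?f x" "\<forall>j. 0 < x $ j \<and> x $ j < real q" by (auto simp: mem_box_cart)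
    then show "y \<in> open_zonotope (\<lambda>j. column j A) (real q) UNIV"
      unfolding open_zonotope_def mem_Collect_eq f by (intro exI[of _ "\<lambda>j. x $ j"]) auto
  qed
  have "(\<chi> j. real q / 2) \<in> box 0 ?b" using q by (simp add: mem_box_cart)
  then have ne: "box 0 ?b \<noteq> {}" by blast
  have "surj ?f" using rank full_rank_surjective[of A] by simp
  then have "open (?f ` box 0 ?b)"
    by (rule open_surjective_linear_image[OF open_box lin])
  then have "?f ` box 0 ?b \<subseteq> interior (?f ` cbox 0 ?b)"
    by (intro interior_maximal image_mono box_subset_cbox)
  then have "interior (?f ` cbox 0 ?b) = rel_interior (?f ` cbox 0 ?b)"
    using ne by (subst rel_interior_nonempty_interior) auto
  also have "\<dots> = ?f ` rel_interior (cbox 0 ?b)"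
    by (rule rel_interior_convex_linear_image[OF lin, symmetric]) simp
  also have "rel_interior (cbox 0 ?b) = box 0 ?b"
    using ne by (subst rel_interior_nonempty_interior) (simp_all add: interior_cbox)
  finally show ?thesis unfolding closed opened .
qed

section \<open>The column matroid\<close>

lemma indep_sets_column_matroid:
  fixes A :: "real^'m^'r"
  shows "indep_sets (column_matroid A) = {S. lin_indep (\<lambda>j. column j A) S}"
  by (simp add: indep_sets_def column_matroid_def lin_indep_iff_independent_image)

lemma rk_column_matroid_attained:
  fixes A :: "real^'m^'r"
  obtains I where "I \<subseteq> S" "lin_indep (\<lambda>j. column j A) I" "card I = rk (column_matroid A) S"
proof -
  let ?C = "{I \<in> indep_sets (column_matroid A). I \<subseteq> S}"
  have "{} \<in> ?C" by (simp add: indep_sets_column_matroid lin_indep_def)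
  then have "rk (column_matroid A) S \<in> card ` ?C"
    unfolding rk_def by (intro Max_in) auto
  then show ?thesis using that by (auto simp: indep_sets_column_matroid)
qed

lemma card_le_rk_column_matroid:
  fixes A :: "real^'m^'r"
  assumes "I \<subseteq> S" "lin_indep (\<lambda>j. column j A) I"
  shows "card I \<le> rk (column_matroid A) S"
  unfolding rk_def using assms by (intro Max_ge) (auto simp: indep_sets_column_matroid)

lemma card_le_rk_column_matroid_iff:
  fixes A :: "real^'m^'r"
  shows "card S \<le> rk (column_matroid A) S \<longleftrightarrow> lin_indep (\<lambda>j. column j A) S"
proof
  assume le: "card S \<le> rk (column_matroid A) S"
  obtain I where I: "I \<subseteq> S" "lin_indep (\<lambda>j. column j A) I" "card I = rk (column_matroid A) S"
    by (rule rk_column_matroid_attained)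
  then have "I = S" using le by (intro card_seteq) auto
  then show "lin_indep (\<lambda>j. column j A) S" using I by simp
qed (rule card_le_rk_column_matroid, simp)

lemma rk_column_matroid_UNIV:
  fixes A :: "real^'m^'r"
  shows "rk (column_matroid A) UNIV = rank A"
proof (rule antisym)
  have C: "columns A = (\<lambda>j. column j A) ` UNIV" by (auto simp: columns_def)
  obtain I where I: "lin_indep (\<lambda>j. column j A) I" "card I = rk (column_matroid A) UNIV"
    using rk_column_matroid_attained by blast
  then have "card I = card ((\<lambda>j. column j A) ` I)" "independent ((\<lambda>j. column j A) ` I)"
    by (simp_all add: lin_indep_iff_independent_image card_image)
  then show "rk (column_matroid A) UNIV \<le> rank A"
    using I(2) independent_card_le_dim[of "(\<lambda>j. column j A) ` I" "columns A"]
    by (auto simp: column_rank_def C)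
  obtain B where B: "B \<subseteq> columns A" "independent B" "card B = dim (columns A)"
    by (rule basis_exists[of "columns A"])
  then obtain I where I: "inj_on (\<lambda>j. column j A) I" "B = (\<lambda>j. column j A) ` I"
    unfolding C subset_image_inj by blast
  then have "lin_indep (\<lambda>j. column j A) I" "card I = rank A"
    using B(2,3) by (simp_all add: lin_indep_iff_independent_image card_image column_rank_def)
  then show "rank A \<le> rk (column_matroid A) UNIV"
    using card_le_rk_column_matroid[of I UNIV A] by simp
qed

text \<open>
At \<open>y = 1\<close> only the sets whose cardinality is their rank survive, by \<open>0 ^ 0 = 1\<close>.
\<close>

lemma tutte_column_matroid_at_one:
  fixes A :: "real^'m^'r" and q :: real
  assumes q: "q \<noteq> 0"
  shows "q ^ rank A * tutte (column_matroid A) (1 - 1 / q) 1 =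
    (\<Sum>S\<in>UNIV. if lin_indep (\<lambda>j. column j A) S then (-1) ^ (rank A + card S) * q ^ card S else 0)"
proof -
  have "q ^ rank A * ((1 - 1 / q - 1) ^ (rk (column_matroid A) UNIV - rk (column_matroid A) S) *
          (1 - 1) ^ (card S - rk (column_matroid A) S)) =
      (if lin_indep (\<lambda>j. column j A) S then (-1) ^ (rank A + card S) * q ^ card S else 0)"
    (is "?L = ?R") for S
  proof (cases "lin_indep (\<lambda>j. column j A) S")
    case True
    have "rk (column_matroid A) S \<le> card S"
      using rk_column_matroid_attained[of S A] by (metis card_mono finite)
    then have rk: "rk (column_matroid A) S = card S"
      using True card_le_rk_column_matroid_iff by (metis le_antisym)
    have "card S \<le> rank A"
      using card_le_rk_column_matroid[of S UNIV A] True by (simp add: rk_column_matroid_UNIV)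
    then obtain d where d: "rank A = card S + d" using le_Suc_ex by blast
    have "q ^ d * (- (1 / q)) ^ d = (-1) ^ d"
      using q by (simp flip: power_mult_distrib)
    moreover have "?L = q ^ card S * (q ^ d * (- (1 / q)) ^ d)"
      by (simp add: rk_column_matroid_UNIV rk d power_add)
    moreover have "(-1) ^ (card S + d + card S) = ((-1) ^ d :: real)"
      by (simp add: power_add)
    ultimately show ?thesis using True by (simp add: d)
  next
    case False
    then have "card S - rk (column_matroid A) S > 0"
      using card_le_rk_column_matroid_iff[of S A] by simp
    then show ?thesis using False by simp
  qed
  then show ?thesis
    unfolding tutte_def by (simp add: ground_def column_matroid_def[THEN arg_cong[of _ _ fst]] sum_distrib_left)
qed

section \<open>Interior lattice points and the Tutte polynomial\<close>

theorem corollary5p2p1: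
  fixes A :: "real^'m^'r" and q :: nat
  assumes "totally_unimodular A"
    and "rank A = CARD('r)"
    and "q > 0"
  shows "real (card (interior (dilate q (zonotope A)) \<inter> lattice_points)) =
    real q ^ rk (column_matroid A) (ground (column_matroid A)) *
      tutte (column_matroid A) (1 - 1 / real q) 1"
proof -
  have dim: "dim (range (\<lambda>j. column j A)) = rank A"
    by (simp add: column_rank_def columns_def full_SetCompr_eq)
  have "int (card (interior (dilate q (zonotope A)) \<inter> lattice_points)) =
      (\<Sum>I\<in>UNIV. if lin_indep (\<lambda>j. column j A) I then (-1) ^ (rank A + card I) * int q ^ card I else 0)"
    using card_lattice_points_open_zonotope[OF finite
        totally_unimodular_imp_unimodular_family[OF assms(1)] assms(3)]
    unfolding interior_dilate_zonotope[OF assms(2,3)] dim Pow_UNIV by (simp only: Int_commute)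
  then have "real_of_int (int (card (interior (dilate q (zonotope A)) \<inter> lattice_points))) =
      (\<Sum>I\<in>UNIV. if lin_indep (\<lambda>j. column j A) I then (-1) ^ (rank A + card I) * real q ^ card I else 0)"
    by (simp only: of_int_sum if_distrib[of real_of_int] of_int_mult of_int_power of_int_minus
        of_int_1 of_int_0 of_int_of_nat_eq)
  also have "\<dots> = real q ^ rank A * tutte (column_matroid A) (1 - 1 / real q) 1"
    using assms(3) by (simp add: tutte_column_matroid_at_one)
  finally show ?thesis
    by (simp add: ground_def rk_column_matroid_UNIV column_matroid_def[THEN arg_cong[of _ _ fst]])
qed

end
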